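(* Consider the 2D scheme $$\overline{\mathbf U}_{ij}^{n+1}=\overline{\mathbf U}_{ij}^n-\frac{\Delta t_n}{\Delta x}\sum_{\beta=1}^Q\omega_\beta\Big(\hat{\mathbf F}_1(\mathbf U_{i+\frac12,\beta}^-,\mathbf U_{i+\frac12,\beta}^+)-\hat{\mathbf F}_1(\mathbf U_{i-\frac12,\beta}^-,\mathbf U_{i-\frac12,\beta}^+)\Big)-\frac{\Delta t_n}{\Delta y}\sum_{\alpha=1}^Q\omega_\alpha\Big(\hat{\mathbf F}_2(\mathbf U_{\alpha,j+\frac12}^-,\mathbf U_{\alpha,j+\frac12}^+)-\hat{\mathbf F}_2(\mathbf U_{\alpha,j-\frac12}^-,\mathbf U_{\alpha,j-\frac12}^+)\Big),$$ $$\hat{\mathbf F}_k(\mathbf U^-,\mathbf U^+)=\frac12\Big(\mathbf F_k(\mathbf U^-)+\mathbf F_k(\mathbf U^+)-(\mathbf U^+-\mathbf U^-)\Big),\quad k=1,2.$$ If the polynomial vectors $\mathbf U_{ij}^n(x,y)=:(D_{ij}(x,y),\mathbf m_{ij}(x,y),\mathbf B_{ij}(x,y),E_{ij}(x,y))^\top$ satisfy (i) the discrete divergence-free conditions $$\frac1{\Delta x}\sum_{\beta=1}^Q\omega_\beta\Big((B_1)_{i+\frac12,\beta}^--(B_1)_{i-\frac12,\beta}^+\Big)+\frac1{\Delta y}\sum_{\beta=1}^Q\omega_\beta\Big((B_2)_{\beta,j+\frac12}^--(B_2)_{\beta,j-\frac12}^+\Big)=0,$$ $$\frac1{\Delta x}\sum_{\beta=1}^Q\omega_\beta\Big((B_1)_{i+\frac12,\beta}^+-(B_1)_{i-\frac12,\beta}^-\Big)+\frac1{\Delta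 y}\sum_{\beta=1}^Q\omega_\beta\Big((B_2)_{\beta,j+\frac12}^+-(B_2)_{\beta,j-\frac12}^-\Big)=0,$$ for all $i$ and $j$, and (ii) $\mathbf U_{ij}^n(\hat x_i^\alpha,y_j^\beta)\in\mathcal G$ and $\mathbf U_{ij}^n(x_i^\beta,\hat y_j^\alpha)\in\mathcal G$ for all $i,j$, all $\alpha=1,\dots,L$ and $\beta=1,\dots,Q$, then under the CFL type condition $$0<\frac{\Delta t_n}{\Delta x}+\frac{\Delta t_n}{\Delta y}\le\hat\omega_1,$$ the solution $\overline{\mathbf U}_{ij}^{n+1}$ of the scheme belongs to $\mathcal G$ for all $i,j$.
   Context: Fix the adiabatic index $\Gamma\in(1,2]$ (equation of state $p=(\Gamma-1)\rho e$; speed of light $c=1$). For primitive variables $\mathbf V=(\rho,\mathbf v,\mathbf B,p)$ with $\rho,p>0$, $\mathbf v,\mathbf B\in\mathbb R^3$, $|\mathbf v|<1$, put $W=(1-|\mathbf v|^2)^{-1/2}$, $e=\frac{p}{(\Gamma-1)\rho}$, $h=1+e+\frac p\rho$, $p_m=\frac12\big(W^{-2}|\mathbf B|^2+(\mathbf v\cdot\mathbf B)^2\big)$, $p_{tot}=p+p_m$. The associated conservative vector is $\mathbf U(\mathbf V)=(D,\mathbf m,\mathbf B,E)^\top\in\mathbb R^8$ with $D=\rho W$, $\mathbf m=\rho hW^2\mathbf v+|\mathbf B|^2\mathbf v-(\mathbf v\cdot\mathbf B)\mathbf B$, $E=\rho hW^2-p_{tot}+|\mathbf B|^2$. The admissible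 state set is $\mathcal G=\{\mathbf U(\mathbf V): \rho>0,\ p>0,\ |\mathbf v|<1,\ \mathbf B\in\mathbb R^3\}$. Each $\mathbf U\in\mathcal G$ determines its primitive variables, and for $\mathbf U\in\mathcal G$ and $k\in\{1,2,3\}$ the flux is $$\mathbf F_k(\mathbf U)=\Big(Dv_k,\ v_k\mathbf m-B_k\big(W^{-2}\mathbf B+(\mathbf v\cdot\mathbf B)\mathbf v\big)+p_{tot}\mathbf e_k,\ v_k\mathbf B-B_k\mathbf v,\ m_k\Big)^\top,$$ with $\mathbf e_k$ the $k$-th row of the $3\times3$ identity matrix. The mesh is uniform rectangular with step sizes $\Delta x,\Delta y>0$ and cells $I_{ij}=(x_{i-\frac12},x_{i+\frac12})\times(y_{j-\frac12},y_{j+\frac12})$, $(i,j)\in\mathbb Z^2$. For each $(i,j)$, $\mathbf U_{ij}^n(x,y)$ is an $\mathbb R^8$-valued polynomial of degree at most $K$ ($K\ge1$) on $I_{ij}$ with cell average $\overline{\mathbf U}_{ij}^n$. $\{x_i^\beta\}_{\beta=1}^Q$ and $\{y_j^\beta\}_{\beta=1}^Q$ are the $Q$ Gauss(–Legendre) nodes transformed to $[x_{i-\frac12},x_{i+\frac12}]$ and $[y_{j-\frac12},y_{j+\frac12}]$, with weights $\omega_\beta$, $\sum_\beta\omega_\beta=1$; $Q$ satisfies $Q\ge K+1$ (DG methods) or $Q\ge(K+1)/2$ (finite volume methods), so in all cases $Q\ge(K+1)/2$. $\{\hat x_i^\alpha\}_{\alpha=1}^L$ and $\{\hat y_j^\alpha\}_{\alpha=1}^L$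 are the $L$ Gauss–Lobatto nodes transformed to the same intervals (including endpoints, in increasing order), with weights $\hat\omega_\alpha$, $\sum_\alpha\hat\omega_\alpha=1$, where $L\ge(K+3)/2$. The edge limiting values are $$\mathbf U_{i+\frac12,\beta}^-=\mathbf U_{ij}^n(x_{i+\frac12},y_j^\beta),\quad \mathbf U_{i-\frac12,\beta}^+=\mathbf U_{ij}^n(x_{i-\frac12},y_j^\beta),\quad \mathbf U_{\beta,j+\frac12}^-=\mathbf U_{ij}^n(x_i^\beta,y_{j+\frac12}),\quad \mathbf U_{\beta,j-\frac12}^+=\mathbf U_{ij}^n(x_i^\beta,y_{j-\frac12}),$$ i.e. the superscript $-$ (resp. $+$) refers to the trace from the cell on the left/below (resp. right/above) of the edge, so that $\mathbf U_{i+\frac12,\beta}^+=\mathbf U_{i+1,j}^n(x_{i+\frac12},y_j^\beta)$, $\mathbf U_{i-\frac12,\beta}^-=\mathbf U_{i-1,j}^n(x_{i-\frac12},y_j^\beta)$, $\mathbf U_{\beta,j+\frac12}^+=\mathbf U_{i,j+1}^n(x_i^\beta,y_{j+\frac12})$, $\mathbf U_{\beta,j-\frac12}^-=\mathbf U_{i,j-1}^n(x_i^\beta,y_{j-\frac12})$. $(B_k)^\pm_{\cdot}$ is the $B_k$ component of the corresponding $\mathbf U^\pm_\cdot$. *)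

theory Defs
  imports "HOL-Analysis.Analysis" "HOL-Computational_Algebra.Polynomial"
begin

section \<open>Relativistic magnetohydrodynamics\<close>

text \<open>Primitive vectors are tuples (rho, v, B, p), conservative ones are tuples (D, m, B, E).
  Spatial indices are elements of the three-element index type 3.\<close>

type_synonym primvec = "real \<times> (real^3) \<times> (real^3) \<times> real"
type_synonym state = "real \<times> (real^3) \<times> (real^3) \<times> real"

definition lorentz :: "real^3 \<Rightarrow> real" where
  "lorentz v = 1 / sqrt (1 - (norm v)\<^sup>2)"

definition internal_energy :: "real \<Rightarrow> real \<Rightarrow> real \<Rightarrow> real" where
  "internal_energy \<Gamma> \<rho> p = p / ((\<Gamma> - 1) * \<rho>)"

definition enthalpy :: "real \<Rightarrow> real \<Rightarrow> real \<Rightarrow> real" where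
  "enthalpy \<Gamma> \<rho> p = 1 + internal_energy \<Gamma> \<rho> p + p / \<rho>"

definition p_mag :: "real^3 \<Rightarrow> real^3 \<Rightarrow> real" where
  "p_mag v B = ((norm B)\<^sup>2 / (lorentz v)\<^sup>2 + (v \<bullet> B)\<^sup>2) / 2"

definition p_total :: "real^3 \<Rightarrow> real^3 \<Rightarrow> real \<Rightarrow> real" where
  "p_total v B p = p + p_mag v B"

definition primitive_states :: "primvec set" where
  "primitive_states = {(\<rho>, v, B, p). \<rho> > 0 \<and> p > 0 \<and> norm v < 1}"

definition conservative :: "real \<Rightarrow> primvec \<Rightarrow> state" where
  "conservative \<Gamma> = (\<lambda>(\<rho>, v, B, p).
     let W = lorentz v; H = \<rho> * enthalpy \<Gamma> \<rho> p * W\<^sup>2 in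
     (\<rho> * W,
      H *\<^sub>R v + (norm B)\<^sup>2 *\<^sub>R v - (v \<bullet> B) *\<^sub>R B,
      B,
      H - p_total v B p + (norm B)\<^sup>2))"

definition admissible :: "real \<Rightarrow> state set" where
  "admissible \<Gamma> = conservative \<Gamma> ` primitive_states"

text \<open>On the admissible set the map from primitive to conservative vectors is invertible;
  \<open>primitive\<close> is its inverse there. It is unspecified for non-admissible states.\<close>

definition primitive :: "real \<Rightarrow> state \<Rightarrow> primvec" where
  "primitive \<Gamma> = inv_into primitive_states (conservative \<Gamma>)"

definition flux :: "real \<Rightarrow> 3 \<Rightarrow> state \<Rightarrow> state" where
  "flux \<Gamma> k U =
     (let (D, m, _, E) = U; (\<rho>, v, B, p) = primitive \<Gamma> U in
      (D * v$k,
       v$k *\<^sub>R m - B$k *\<^sub>R ((1 / (lorentz v)\<^sup>2) *\<^sub>R B + (v \<bullet> B) *\<^sub>R v)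
         + p_total v B p *\<^sub>R axis k 1,
       v$k *\<^sub>R B - B$k *\<^sub>R v,
       m$k))"

definition numerical_flux :: "real \<Rightarrow> 3 \<Rightarrow> state \<Rightarrow> state \<Rightarrow> state" where
  "numerical_flux \<Gamma> k Um Up = (1/2) *\<^sub>R (flux \<Gamma> k Um + flux \<Gamma> k Up - (Up - Um))"

definition magnetic :: "state \<Rightarrow> real^3" where
  "magnetic = (\<lambda>(D, m, B, E). B)"


section \<open>Polynomials and quadrature\<close>

text \<open>Degree means total degree.\<close>

definition poly2_le :: "nat \<Rightarrow> (real \<Rightarrow> real \<Rightarrow> 'a::real_vector) \<Rightarrow> bool" where
  "poly2_le K f \<longleftrightarrow>
     (\<exists>c :: nat \<Rightarrow> nat \<Rightarrow> 'a. \<forall>x y. f x y = (\<Sum>a\<le>K. \<Sum>b\<le>K - a. (x ^ a * y ^ b) *\<^sub>R c a b))"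

text \<open>Legendre polynomials by Rodrigues' formula.\<close>

definition legendre :: "nat \<Rightarrow> real poly" where
  "legendre n = smult (1 / (2 ^ n * fact n)) ((pderiv ^^ n) ([:-1, 0, 1:] ^ n))"

text \<open>Weight number \<open>b\<close> of the interpolatory rule with nodes \<open>\<xi> 1, \<dots>, \<xi> n\<close> on [-1,1]: the mean
  value of the Lagrange basis polynomial. The weights are thus normalized to have sum 1.\<close>

definition interpolatory_weight :: "nat \<Rightarrow> (nat \<Rightarrow> real) \<Rightarrow> nat \<Rightarrow> real" where
  "interpolatory_weight n \<xi> b =
     integral {-1..1} (\<lambda>t. \<Prod>c\<in>{1..n} - {b}. (t - \<xi> c) / (\<xi> b - \<xi> c)) / 2"

definition gauss_legendre_rule :: "nat \<Rightarrow> (nat \<Rightarrow> real) \<Rightarrow> (nat \<Rightarrow> real) \<Rightarrow> bool" where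
  "gauss_legendre_rule n \<xi> \<omega> \<longleftrightarrow>
     bij_betw \<xi> {1..n} {t. poly (legendre n) t = 0} \<and>
     (\<forall>b\<in>{1..n}. \<omega> b = interpolatory_weight n \<xi> b)"

text \<open>The interior Gauss--Lobatto nodes are the zeros of the derivative of the Legendre
  polynomial of degree \<open>n - 1\<close>.\<close>

definition gauss_lobatto_rule :: "nat \<Rightarrow> (nat \<Rightarrow> real) \<Rightarrow> (nat \<Rightarrow> real) \<Rightarrow> bool" where
  "gauss_lobatto_rule n \<xi> \<omega> \<longleftrightarrow>
     strict_mono_on {1..n} \<xi> \<and>
     \<xi> ` {1..n} = {-1, 1} \<union> {t. poly (pderiv (legendre (n - 1))) t = 0} \<and>
     (\<forall>b\<in>{1..n}. \<omega> b = interpolatory_weight n \<xi> b)"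


section \<open>Mesh\<close>

text \<open>In each direction a mesh is given by its interfaces: \<open>z i\<close> stands for $z_{i+1/2}$, so cell \<open>i\<close>
  is the interval from \<open>z (i - 1)\<close> to \<open>z i\<close>.\<close>

definition cell_node :: "(int \<Rightarrow> real) \<Rightarrow> (nat \<Rightarrow> real) \<Rightarrow> int \<Rightarrow> nat \<Rightarrow> real" where
  "cell_node z \<xi> i b = (z (i - 1) + z i) / 2 + (z i - z (i - 1)) / 2 * \<xi> b"

definition cell_average ::
  "(int \<Rightarrow> real) \<Rightarrow> (int \<Rightarrow> real) \<Rightarrow> (int \<Rightarrow> int \<Rightarrow> real \<Rightarrow> real \<Rightarrow> 'a::euclidean_space) \<Rightarrow> int \<Rightarrow> int \<Rightarrow> 'a"
where
  "cell_average xe ye U i j =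
     (1 / ((xe i - xe (i - 1)) * (ye j - ye (j - 1)))) *\<^sub>R
       integral ({xe (i - 1)<..<xe i} \<times> {ye (j - 1)<..<ye j}) (\<lambda>(x, y). U i j x y)"

end

theory Submission
  imports Defs
begin

text \<open>The set of admissible states is cut out by linear inequalities. For a timelike direction,
given by a velocity \<open>u\<close> with \<open>norm u < 1\<close>, and a magnetic vector \<open>C\<close>, put \<open>\<phi> U = U \<bullet>
lorentz_normal u C\<close>. Then \<open>U\<close> is admissible iff its density component is positive and \<open>\<phi> U +
p_mag u C > 0\<close> for all \<open>u\<close> and \<open>C\<close>. So admissibility of the new cell average only has to be
tested on one linear functional at a time, and for these it is a matter of signs.

The implication from the inequalities to admissibility (\<open>admissibleI\<close>) is the recovery of
primitive variables, done with two applications of the intermediate value theorem to functions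
of the single unknown \<open>H = \<rho> h W\<^sup>2\<close>. The first locates the value of \<open>H\<close> at which the pressure
would vanish. The inequality for \<open>u\<close> and \<open>C\<close> equal to the velocity and the magnetic field of
that pressureless state says exactly that its energy is below \<open>E\<close>, so that the energy equation
is solved further up, with positive pressure.

The converse is contained in a stronger inequality (\<open>flux_splitting\<close>): for both signs \<open>\<sigma>\<close>, \<open>\<phi> U
+ p_mag u C + \<sigma> (\<phi> (F\<^sub>k U) + u\<^sub>k p_mag u C - B\<^sub>k (u \<bullet> C)) > 0\<close>. The fluid part of the left side
is the stress-energy tensor of the fluid contracted with a timelike and a lightlike vector, less
the flux of rest mass (\<open>fluid_splitting\<close>); it is positive by the Cauchy--Schwarz inequality and
by \<open>\<Gamma> \<le> 2\<close>. The magnetic part (\<open>magnetic_splitting\<close>) is the same contraction for an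
electromagnetic field, namely the difference of the fields belonging to \<open>(v, B)\<close> and to \<open>(u,
C)\<close>, and it is nonnegative because electromagnetic fields satisfy the dominant energy condition.

The cell average is a convex combination of point values in two ways, with Gauss nodes in one
direction and Gauss--Lobatto nodes in the other. Weighting the two by \<open>dt / dx\<close> and \<open>dt / dy\<close>,
the scheme becomes a convex combination of one-dimensional updates, each with time step ratio
\<open>dt / dx + dt / dy\<close>. Under the CFL condition the end point weights \<open>\<omega>' 1 = \<omega>' L\<close> dominate what
the numerical fluxes subtract at the two end points, and the remaining terms are halves of
quantities \<open>U \<plusminus> F\<^sub>k U\<close>, to which the splitting inequality applies
(\<open>one_dimensional_positivity\<close>). This leaves the terms \<open>u\<^sub>k p_mag u C\<close>, which cancel between
opposite edges, and the terms \<open>B\<^sub>k (u \<bullet> C)\<close>, whose total is the sum of the two discrete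
divergences and therefore zero.\<close>

section \<open>The linear functionals\<close>

text \<open>Times \<open>lorentz u\<close>, this pairs energy and momentum with the four-velocity of \<open>u\<close> and the
density with \<open>- 1\<close>. The magnetic component is \<open>- (C - u \<times> f)\<close>, where \<open>f = - u \<times> C\<close> is the
electric field that \<open>u\<close> and \<open>C\<close> produce.\<close>

definition lorentz_normal :: "real^3 \<Rightarrow> real^3 \<Rightarrow> state" where
  "lorentz_normal u C =
     (- sqrt (1 - (norm u)\<^sup>2), - u, - ((1 - (norm u)\<^sup>2) *\<^sub>R C + (u \<bullet> C) *\<^sub>R u), 1)"

lemma norm_less_1_square: "norm (v::real^3) < 1 \<Longrightarrow> (norm v)\<^sup>2 < 1"
  by (simp add: abs_square_less_1)

lemma inverse_lorentz_square: "norm v < 1 \<Longrightarrow> 1 / (lorentz v)\<^sup>2 = 1 - (norm v)\<^sup>2"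
  using norm_less_1_square[of v] by (simp add: lorentz_def power_divide)

lemma p_mag_eq:
  "norm v < 1 \<Longrightarrow> p_mag v B = ((1 - (norm v)\<^sup>2) * (norm B)\<^sup>2 + (v \<bullet> B)\<^sup>2) / 2"
  using norm_less_1_square[of v] by (simp add: p_mag_def lorentz_def power_divide)

lemma enthalpy_eq:
  assumes "\<rho> > 0" "\<Gamma> > 1"
  shows "\<rho> * enthalpy \<Gamma> \<rho> p = \<rho> + \<Gamma> / (\<Gamma> - 1) * p"
  using assms by (simp add: enthalpy_def internal_energy_def field_simps)

section \<open>The splitting inequality for the flux\<close>

text \<open>The Maxwell stress-energy tensor of electric field \<open>e\<close> and magnetic field \<open>b\<close>, contracted
with \<open>(1, -1, 0, 0)\<close> and \<open>(1, u)\<close> and doubled. Waves moving along the lightlike vector do not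
contribute, so that the transverse fields enter only through \<open>P = e2 + b3\<close> and \<open>Q = e3 - b2\<close>.
Together with \<open>e1\<close> and \<open>b1\<close> they give \<open>(1 - u1) X\<^sup>2 + (1 + u1) Y\<^sup>2\<close> plus a cross term, and \<open>u2\<^sup>2
+ u3\<^sup>2 \<le> (1 - u1) (1 + u1)\<close> makes this dominate a square.\<close>

lemma dominant_energy_condition:
  fixes e1 e2 e3 b1 b2 b3 u1 u2 u3 :: real
  assumes u: "u1\<^sup>2 + u2\<^sup>2 + u3\<^sup>2 \<le> 1"
  shows "0 \<le> (1 - u1) * (e1\<^sup>2 + e2\<^sup>2 + e3\<^sup>2 + b1\<^sup>2 + b2\<^sup>2 + b3\<^sup>2)
    + 2 * (1 - u1) * (e2 * b3 - e3 * b2)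
    - 2 * u2 * (e3 * b1 - e1 * b3) - 2 * u3 * (e1 * b2 - e2 * b1)
    + 2 * e1 * (e1 * u1 + e2 * u2 + e3 * u3) + 2 * b1 * (b1 * u1 + b2 * u2 + b3 * u3)" (is "0 \<le> ?M")
proof -
  define P Q where "P = e2 + b3" and "Q = e3 - b2"
  define X Y where "X = sqrt (P\<^sup>2 + Q\<^sup>2)" and "Y = sqrt (e1\<^sup>2 + b1\<^sup>2)"
  define s t where "s = sqrt (1 - u1)" and "t = sqrt (1 + u1)"
  have u1: "u1\<^sup>2 \<le> 1" using u by (smt (verit) zero_le_power2)
  then have u1': "-1 \<le> u1" "u1 \<le> 1" by (simp_all add: abs_square_le_1 abs_le_iff)
  have M: "?M = (1 - u1) * (P\<^sup>2 + Q\<^sup>2) + (1 + u1) * (e1\<^sup>2 + b1\<^sup>2)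
    + 2 * (u2 * (e1 * P - b1 * Q) + u3 * (e1 * Q + b1 * P))"
    unfolding P_def Q_def by (simp add: field_simps power2_eq_square)
  have "(u2 * (e1 * P - b1 * Q) + u3 * (e1 * Q + b1 * P))\<^sup>2
      \<le> (u2\<^sup>2 + u3\<^sup>2) * ((e1 * P - b1 * Q)\<^sup>2 + (e1 * Q + b1 * P)\<^sup>2)"
    using zero_le_power2[of "u2 * (e1 * Q + b1 * P) - u3 * (e1 * P - b1 * Q)"]
    by (simp add: algebra_simps power2_eq_square)
  also have "\<dots> = (u2\<^sup>2 + u3\<^sup>2) * (X\<^sup>2 * Y\<^sup>2)"
    by (simp add: X_def Y_def) (simp add: algebra_simps power2_eq_square)
  also have "\<dots> \<le> (s\<^sup>2 * t\<^sup>2) * (X\<^sup>2 * Y\<^sup>2)"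
  proof (rule mult_right_mono)
    have "s\<^sup>2 * t\<^sup>2 = 1 - u1\<^sup>2"
      using u1' by (simp add: s_def t_def) (simp add: algebra_simps power2_eq_square)
    then show "u2\<^sup>2 + u3\<^sup>2 \<le> s\<^sup>2 * t\<^sup>2" using u by simp
  qed simp
  finally have "(u2 * (e1 * P - b1 * Q) + u3 * (e1 * Q + b1 * P))\<^sup>2 \<le> (s * X * (t * Y))\<^sup>2"
    by (simp add: power_mult_distrib mult_ac)
  moreover have "0 \<le> s * X * (t * Y)"
    using u1' by (simp add: s_def t_def X_def Y_def)
  ultimately have cross: "\<bar>u2 * (e1 * P - b1 * Q) + u3 * (e1 * Q + b1 * P)\<bar> \<le> s * X * (t * Y)"
    by (metis abs_le_square_iff abs_of_nonneg)
  have "?M = (s * X)\<^sup>2 + (t * Y)\<^sup>2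
      + 2 * (u2 * (e1 * P - b1 * Q) + u3 * (e1 * Q + b1 * P))"
    unfolding M using u1' by (simp add: power_mult_distrib s_def t_def X_def Y_def)
  also have "\<dots> \<ge> (s * X)\<^sup>2 + (t * Y)\<^sup>2 + 2 * (- (s * X * (t * Y)))"
    using cross by (intro add_left_mono mult_left_mono) linarith+
  also have "(s * X)\<^sup>2 + (t * Y)\<^sup>2 + 2 * (- (s * X * (t * Y))) = (s * X - t * Y)\<^sup>2"
    by (simp add: power2_diff)
  finally show ?thesis using zero_le_power2 by (rule order.trans[rotated])
qed

text \<open>The relations in \<open>v, B, u, C\<close> become bilinear once the electric fields \<open>e = - v \<times> B\<close> and
\<open>f = - u \<times> C\<close> are introduced: \<open>M\<close> is the Poynting vector \<open>e \<times> B\<close>, \<open>pm\<close> and \<open>qm\<close> are \<open>(B\<^sup>2 - e\<^sup>2)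
/ 2\<close> and \<open>(C\<^sup>2 - f\<^sup>2) / 2\<close>, and the momentum flux is the Maxwell stress. The whole expression is
then the one of \<open>dominant_energy_condition\<close> for the fields \<open>e - f\<close> and \<open>B - C\<close>; the subtracted
term \<open>B1 * uC\<close> is what makes the mixed terms agree. The quantities are kept as separate
variables, since the fully expanded polynomial is too large to be compared at once.\<close>

lemma magnetic_splitting_components:
  fixes v1 v2 v3 B1 B2 B3 u1 u2 u3 C1 C2 C3 :: real
  assumes u: "u1\<^sup>2 + u2\<^sup>2 + u3\<^sup>2 \<le> 1"
    and vB: "vB = v1 * B1 + v2 * B2 + v3 * B3"
    and uC: "uC = u1 * C1 + u2 * C2 + u3 * C3"
    and BB: "BB = B1\<^sup>2 + B2\<^sup>2 + B3\<^sup>2"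
    and VV: "VV = 1 - (v1\<^sup>2 + v2\<^sup>2 + v3\<^sup>2)"
    and UU: "UU = 1 - (u1\<^sup>2 + u2\<^sup>2 + u3\<^sup>2)"
    and pm: "2 * pm = VV * BB + vB\<^sup>2"
    and qm: "2 * qm = UU * (C1\<^sup>2 + C2\<^sup>2 + C3\<^sup>2) + uC\<^sup>2"
    and M: "M1 = BB * v1 - vB * B1" "M2 = BB * v2 - vB * B2" "M3 = BB * v3 - vB * B3"
    and N: "N1 = VV * B1 + vB * v1" "N2 = VV * B2 + vB * v2" "N3 = VV * B3 + vB * v3"
    and c: "c1 = UU * C1 + uC * u1" "c2 = UU * C2 + uC * u2" "c3 = UU * C3 + uC * u3"
  shows "0 \<le> BB - pm + qm - (M1 * u1 + M2 * u2 + M3 * u3) - (B1 * c1 + B2 * c2 + B3 * c3)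
    + (M1 - v1 * (M1 * u1 + M2 * u2 + M3 * u3) + B1 * (N1 * u1 + N2 * u2 + N3 * u3)
      - pm * u1 - v1 * (B1 * c1 + B2 * c2 + B3 * c3) + B1 * (v1 * c1 + v2 * c2 + v3 * c3)
      + u1 * qm - B1 * uC)" (is "0 \<le> ?rhs")
proof -
  \<comment> \<open>the electric fields \<open>- v \<times> B\<close> and \<open>- u \<times> C\<close>\<close>
  define e1 e2 e3 where e:
    "e1 = v3 * B2 - v2 * B3" "e2 = v1 * B3 - v3 * B1" "e3 = v2 * B1 - v1 * B2"
  define f1 f2 f3 where f:
    "f1 = u3 * C2 - u2 * C3" "f2 = u1 * C3 - u3 * C1" "f3 = u2 * C1 - u1 * C2"
  have poynting: "M1 = e2 * B3 - e3 * B2" "M2 = e3 * B1 - e1 * B3" "M3 = e1 * B2 - e2 * B1"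
    unfolding M BB vB e by (simp_all add: algebra_simps power2_eq_square)
  have comoving: "c1 = C1 - (u2 * f3 - u3 * f2)" "c2 = C2 - (u3 * f1 - u1 * f3)"
    "c3 = C3 - (u1 * f2 - u2 * f1)"
    unfolding c UU uC f by (simp_all add: algebra_simps power2_eq_square)
  have pm2: "2 * pm = BB - (e1\<^sup>2 + e2\<^sup>2 + e3\<^sup>2)"
    unfolding pm BB VV vB e by (simp add: algebra_simps power2_eq_square)
  have qm2: "2 * qm = (C1\<^sup>2 + C2\<^sup>2 + C3\<^sup>2) - (f1\<^sup>2 + f2\<^sup>2 + f3\<^sup>2)"
    unfolding qm UU uC f by (simp add: algebra_simps power2_eq_square)
  have stress: "2 * (v1 * M1 - B1 * N1) + 2 * pm = e1\<^sup>2 + e2\<^sup>2 + e3\<^sup>2 + BB - 2 * e1\<^sup>2 - 2 * B1\<^sup>2"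
    "v1 * M2 - B1 * N2 = - e1 * e2 - B1 * B2"
    "v1 * M3 - B1 * N3 = - e1 * e3 - B1 * B3"
    unfolding M N BB VV vB pm e by (simp_all add: algebra_simps power2_eq_square)
  define S1 S2 S3 where S: "S1 = 2 * (v1 * M1 - B1 * N1) + 2 * pm" "S2 = v1 * M2 - B1 * N2"
     "S3 = v1 * M3 - B1 * N3"
  have "2 * ?rhs = 2 * BB - 2 * pm + (1 + u1) * (2 * qm)
      - 2 * (M1 * u1 + M2 * u2 + M3 * u3) - 2 * (B1 * c1 + B2 * c2 + B3 * c3) + 2 * M1
      - S1 * u1 - 2 * S2 * u2 - 2 * S3 * u3 + 2 * e3 * c2 - 2 * e2 * c3 - 2 * B1 * uC"
    unfolding S e by (simp add: algebra_simps)
  also have "\<dots> = (1 - u1) * ((e1 - f1)\<^sup>2 + (e2 - f2)\<^sup>2 + (e3 - f3)\<^sup>2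
         + (B1 - C1)\<^sup>2 + (B2 - C2)\<^sup>2 + (B3 - C3)\<^sup>2)
    + 2 * (1 - u1) * ((e2 - f2) * (B3 - C3) - (e3 - f3) * (B2 - C2))
    - 2 * u2 * ((e3 - f3) * (B1 - C1) - (e1 - f1) * (B3 - C3))
    - 2 * u3 * ((e1 - f1) * (B2 - C2) - (e2 - f2) * (B1 - C1))
    + 2 * (e1 - f1) * ((e1 - f1) * u1 + (e2 - f2) * u2 + (e3 - f3) * u3)
    + 2 * (B1 - C1) * ((B1 - C1) * u1 + (B2 - C2) * u2 + (B3 - C3) * u3)"
    unfolding pm2 qm2 stress[folded S] comoving poynting BB uC f
    by (simp add: algebra_simps power2_eq_square)
  also have "\<dots> \<ge> 0"
    by (rule dominant_energy_condition[OF u])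
  finally show ?thesis
    by (simp only: zero_le_mult_iff) simp
qed

text \<open>The stress-energy tensor of the fluid contracted with the lightlike vector \<open>(1, - n)\<close> and
with \<open>(1, u)\<close>, less the flux of rest mass. The part proportional to \<open>\<rho>\<close> is nonnegative because
four-velocities satisfy the reversed Cauchy--Schwarz inequality. The pressure contributes \<open>\<Gamma> /
(\<Gamma> - 1) a W\<^sup>2 c - b\<close>, which is positive because \<open>\<Gamma> \<le> 2\<close> makes the first coefficient at least \<open>2\<close>
and \<open>2 a W\<^sup>2 c - b\<close> is the contraction of \<open>(1, u)\<close> with another lightlike vector, the one
obtained by reversing the spatial direction in the rest frame of the fluid.\<close>

lemma fluid_splitting:
  fixes v u n :: "real^3"
  assumes n: "norm n = 1" and v: "norm v < 1" and u: "norm u < 1"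
    and \<rho>: "\<rho> > 0" and p: "p > 0" and \<Gamma>: "1 < \<Gamma>" "\<Gamma> \<le> 2"
  defines "H \<equiv> \<rho> * enthalpy \<Gamma> \<rho> p * (lorentz v)\<^sup>2"
  shows "(1 + n \<bullet> v) * (H * (1 - v \<bullet> u) - \<rho> * lorentz v * sqrt (1 - (norm u)\<^sup>2))
           - p * (1 + n \<bullet> u) > 0"
proof -
  define W where "W = lorentz v"
  define a b c where "a = 1 + n \<bullet> v" and "b = 1 + n \<bullet> u" and "c = 1 - v \<bullet> u"
  define w where "w = 1 - (norm v)\<^sup>2"
  have w: "0 < w" using norm_less_1_square[OF v] by (simp add: w_def)
  have W: "W > 0" "W\<^sup>2 = 1 / w" "W = 1 / sqrt w"
    using w by (simp_all add: W_def w_def lorentz_def power_divide)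
  have "\<bar>n \<bullet> v\<bar> \<le> norm v" using Cauchy_Schwarz_ineq2[of n v] n by simp
  then have a: "a > 0" using v by (simp add: a_def)
  have nv: "n \<bullet> n = 1" using n by (simp add: dot_square_norm)
  have d: "2 * a - w = (norm (v + n))\<^sup>2"
    by (simp add: a_def w_def power2_norm_eq_inner inner_add inner_commute nv algebra_simps)
  have "v \<noteq> - n" using v n by auto
  then have dpos: "2 * a - w > 0"
    unfolding d by (metis add_eq_0_iff2 zero_less_norm_iff zero_less_power)
  \<comment> \<open>\<open>(2 * a - w, 2 * a * v + w * n)\<close> is \<open>w\<close> times the reversed lightlike vector\<close>
  have "(norm ((2 * a) *\<^sub>R v + w *\<^sub>R n))\<^sup>2 = (2 * a - w)\<^sup>2"
    unfolding power2_norm_eq_inner a_def w_def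
    by (simp add: inner_add inner_commute nv power2_eq_square algebra_simps)
  then have nrm: "norm ((2 * a) *\<^sub>R v + w *\<^sub>R n) = 2 * a - w"
    using dpos by (smt (verit) norm_ge_zero power2_eq_iff_nonneg)
  have eq: "2 * a * c - w * b = (2 * a - w) - ((2 * a) *\<^sub>R v + w *\<^sub>R n) \<bullet> u"
    by (simp add: b_def c_def inner_add_left algebra_simps)
  have "((2 * a) *\<^sub>R v + w *\<^sub>R n) \<bullet> u \<le> (2 * a - w) * norm u"
    using norm_cauchy_schwarz[of "(2 * a) *\<^sub>R v + w *\<^sub>R n" u] nrm by simp
  also have "\<dots> < (2 * a - w) * 1"
    using dpos u by (intro mult_strict_left_mono)
  finally have "0 < 2 * a * c - w * b" unfolding eq by simp
  then have "w * b < 2 * a * c" by simp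
  then have b: "b < 2 * a * W\<^sup>2 * c"
    unfolding W using w by (simp add: field_simps)
  have vu: "v \<bullet> u \<le> norm v * norm u" by (rule norm_cauchy_schwarz)
  have "norm v * norm u \<le> 1" using v u by (intro mult_le_one) auto
  have "w * (1 - (norm u)\<^sup>2) \<le> (1 - norm v * norm u)\<^sup>2"
    using zero_le_power2[of "norm v - norm u"]
    unfolding w_def by (simp add: power2_eq_square algebra_simps)
  then have "sqrt (w * (1 - (norm u)\<^sup>2)) \<le> 1 - norm v * norm u"
    using \<open>norm v * norm u \<le> 1\<close> real_sqrt_le_mono by fastforce
  then have c: "sqrt w * sqrt (1 - (norm u)\<^sup>2) \<le> c"
    using vu by (simp add: c_def real_sqrt_mult)
  then have "0 \<le> W\<^sup>2 * (c - sqrt w * sqrt (1 - (norm u)\<^sup>2))" by simp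
  also have "\<dots> = W\<^sup>2 * c - W * sqrt (1 - (norm u)\<^sup>2)"
    using w unfolding W by (simp add: field_simps)
  finally have "0 \<le> \<rho> * a * (W\<^sup>2 * c - W * sqrt (1 - (norm u)\<^sup>2))"
    using \<rho> a by simp
  moreover have "0 < p * (\<Gamma> / (\<Gamma> - 1) * (a * W\<^sup>2 * c) - b)"
  proof -
    have "0 \<le> c"
      using c norm_less_1_square[OF u] w by (smt (verit) mult_nonneg_nonneg real_sqrt_ge_zero)
    moreover have "2 \<le> \<Gamma> / (\<Gamma> - 1)" using \<Gamma> by (simp add: field_simps)
    ultimately have "2 * (a * W\<^sup>2 * c) \<le> \<Gamma> / (\<Gamma> - 1) * (a * W\<^sup>2 * c)"
      using a by (intro mult_right_mono) auto
    then show ?thesis using b p by simp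
  qed
  moreover have "(1 + n \<bullet> v) * (H * (1 - v \<bullet> u) - \<rho> * lorentz v * sqrt (1 - (norm u)\<^sup>2))
           - p * (1 + n \<bullet> u) = \<rho> * a * (W\<^sup>2 * c - W * sqrt (1 - (norm u)\<^sup>2))
     + p * (\<Gamma> / (\<Gamma> - 1) * (a * W\<^sup>2 * c) - b)"
    unfolding H_def enthalpy_eq[OF \<rho> \<Gamma>(1)] a_def[symmetric] b_def[symmetric] c_def[symmetric]
      W_def[symmetric] by (simp only: algebra_simps power2_eq_square)
  ultimately show ?thesis by linarith
qed

text \<open>Singles out one direction, so that a computation for the first coordinate serves for all
three; the order of the other two does not matter, as the formulas for flux and magnetic
pressure contain no cross product.\<close>

lemma inner_3_coordinates:
  fixes k :: 3
  obtains i j where "\<And>x y :: real^3. x \<bullet> y = x $ k * y $ k + x $ i * y $ i + x $ j * y $ j"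
proof -
  have "\<exists>i j. \<forall>x y :: real^3. x \<bullet> y = x $ k * y $ k + x $ i * y $ i + x $ j * y $ j"
    using exhaust_3[of k]
  proof (elim disjE)
    assume "k = 1" then show ?thesis
      by (intro exI[of _ 2] exI[of _ 3]) (simp add: inner_vec_def sum_3)
  next
    assume "k = 2" then show ?thesis
      by (intro exI[of _ 1] exI[of _ 3]) (simp add: inner_vec_def sum_3)
  next
    assume "k = 3" then show ?thesis
      by (intro exI[of _ 1] exI[of _ 2]) (simp add: inner_vec_def sum_3)
  qed
  then show ?thesis using that by blast
qed

lemma magnetic_splitting_right:
  fixes v u B C :: "real^3" and k :: 3
  assumes v: "norm v < 1" and u: "norm u < 1"
    and M: "M = (norm B)\<^sup>2 *\<^sub>R v - (v \<bullet> B) *\<^sub>R B"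
    and N: "N = (1 - (norm v)\<^sup>2) *\<^sub>R B + (v \<bullet> B) *\<^sub>R v"
    and c: "c = (1 - (norm u)\<^sup>2) *\<^sub>R C + (u \<bullet> C) *\<^sub>R u"
  shows "0 \<le> (norm B)\<^sup>2 - p_mag v B + p_mag u C - M \<bullet> u - B \<bullet> c
    + (M $ k - (v $ k *\<^sub>R M - B $ k *\<^sub>R N + p_mag v B *\<^sub>R axis k 1) \<bullet> u
       - (v $ k *\<^sub>R B - B $ k *\<^sub>R v) \<bullet> c + u $ k * p_mag u C - B $ k * (u \<bullet> C))"
proof -
  obtain i j where inner: "\<And>x y :: real^3. x \<bullet> y = x $ k * y $ k + x $ i * y $ i + x $ j * y $ j"
    using inner_3_coordinates[of k] by metis
  have norm: "(norm x)\<^sup>2 = (x $ k)\<^sup>2 + (x $ i)\<^sup>2 + (x $ j)\<^sup>2" for x :: "real^3"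
    by (simp only: power2_norm_eq_inner inner) (simp add: power2_eq_square)
  have le: "(u $ k)\<^sup>2 + (u $ i)\<^sup>2 + (u $ j)\<^sup>2 \<le> 1"
    using norm_less_1_square[OF u] norm by simp
  have pm: "2 * p_mag v B = (1 - (norm v)\<^sup>2) * (norm B)\<^sup>2 + (v \<bullet> B)\<^sup>2"
    "2 * p_mag u C = (1 - (norm u)\<^sup>2) * ((C $ k)\<^sup>2 + (C $ i)\<^sup>2 + (C $ j)\<^sup>2) + (u \<bullet> C)\<^sup>2"
    by (simp_all add: p_mag_eq v u flip: norm)
  have "0 \<le> (norm B)\<^sup>2 - p_mag v B + p_mag u C
      - (M $ k * u $ k + M $ i * u $ i + M $ j * u $ j)
      - (B $ k * c $ k + B $ i * c $ i + B $ j * c $ j)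
    + (M $ k - v $ k * (M $ k * u $ k + M $ i * u $ i + M $ j * u $ j)
      + B $ k * (N $ k * u $ k + N $ i * u $ i + N $ j * u $ j)
      - p_mag v B * u $ k - v $ k * (B $ k * c $ k + B $ i * c $ i + B $ j * c $ j)
      + B $ k * (v $ k * c $ k + v $ i * c $ i + v $ j * c $ j)
      + u $ k * p_mag u C - B $ k * (u \<bullet> C))"
    by (rule magnetic_splitting_components[OF le inner inner norm _ _ pm]) (simp_all add: M N c norm)
  also have "\<dots> = (norm B)\<^sup>2 - p_mag v B + p_mag u C - M \<bullet> u - B \<bullet> c
    + (M $ k - (v $ k *\<^sub>R M - B $ k *\<^sub>R N + p_mag v B *\<^sub>R axis k 1) \<bullet> u
       - (v $ k *\<^sub>R B - B $ k *\<^sub>R v) \<bullet> c + u $ k * p_mag u C - B $ k * (u \<bullet> C))"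
    by (simp add: inner_diff_left inner_add_left inner_axis' flip: inner)
  finally show ?thesis .
qed

lemma p_mag_minus [simp]: "p_mag (- v) B = p_mag v B"
  by (simp add: p_mag_def lorentz_def)

lemma magnetic_splitting:
  fixes v u B C :: "real^3" and k :: 3 and \<sigma> :: real
  assumes \<sigma>: "\<sigma> \<in> {1, -1}" and v: "norm v < 1" and u: "norm u < 1"
    and M: "M = (norm B)\<^sup>2 *\<^sub>R v - (v \<bullet> B) *\<^sub>R B"
    and N: "N = (1 - (norm v)\<^sup>2) *\<^sub>R B + (v \<bullet> B) *\<^sub>R v"
    and c: "c = (1 - (norm u)\<^sup>2) *\<^sub>R C + (u \<bullet> C) *\<^sub>R u"
  shows "0 \<le> (norm B)\<^sup>2 - p_mag v B + p_mag u C - M \<bullet> u - B \<bullet> c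
    + \<sigma> * (M $ k - (v $ k *\<^sub>R M - B $ k *\<^sub>R N + p_mag v B *\<^sub>R axis k 1) \<bullet> u
       - (v $ k *\<^sub>R B - B $ k *\<^sub>R v) \<bullet> c + u $ k * p_mag u C - B $ k * (u \<bullet> C))"
proof (cases "\<sigma> = 1")
  case True
  then show ?thesis using magnetic_splitting_right[OF v u M N c, of k] by simp
next
  case False
  then have "\<sigma> = -1" using \<sigma> by simp
  \<comment> \<open>reversing both velocities reverses the flux but changes none of the other terms\<close>
  moreover have "0 \<le> (norm B)\<^sup>2 - p_mag (- v) B + p_mag (- u) C - (- M) \<bullet> (- u) - B \<bullet> c
    + ((- M) $ k - ((- v) $ k *\<^sub>R (- M) - B $ k *\<^sub>R N + p_mag (- v) B *\<^sub>R axis k 1) \<bullet> (- u)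
       - ((- v) $ k *\<^sub>R B - B $ k *\<^sub>R (- v)) \<bullet> c + (- u) $ k * p_mag (- u) C
       - B $ k * ((- u) \<bullet> C))"
    by (rule magnetic_splitting_right) (simp_all add: v u M N c)
  ultimately show ?thesis
    by (simp add: inner_diff_left inner_add_left)
qed

text \<open>All quantities refer to the primitive vector chosen by \<open>primitive\<close>, through which the
flux is defined.\<close>

lemma admissible_flux:
  assumes "U \<in> admissible \<Gamma>"
  obtains \<rho> v B p H M where
    "\<rho> > 0" "p > 0" "norm v < 1"
    "H = \<rho> * enthalpy \<Gamma> \<rho> p * (lorentz v)\<^sup>2"
    "M = (norm B)\<^sup>2 *\<^sub>R v - (v \<bullet> B) *\<^sub>R B"
    "U = (\<rho> * lorentz v, H *\<^sub>R v + M, B, H - p_total v B p + (norm B)\<^sup>2)"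
    "\<And>k. flux \<Gamma> k U = (\<rho> * lorentz v * v $ k,
       v $ k *\<^sub>R (H *\<^sub>R v + M) - B $ k *\<^sub>R ((1 - (norm v)\<^sup>2) *\<^sub>R B + (v \<bullet> B) *\<^sub>R v)
         + p_total v B p *\<^sub>R axis k 1,
       v $ k *\<^sub>R B - B $ k *\<^sub>R v, (H *\<^sub>R v + M) $ k)"
proof -
  obtain \<rho> v B p where P: "primitive \<Gamma> U = (\<rho>, v, B, p)"
    by (metis prod_cases4)
  have "(\<rho>, v, B, p) \<in> primitive_states" "conservative \<Gamma> (\<rho>, v, B, p) = U"
    using assms unfolding admissible_def P[symmetric] primitive_def
    by (auto intro: inv_into_into f_inv_into_f)
  then have pos: "\<rho> > 0" "p > 0" "norm v < 1" and U: "U = conservative \<Gamma> (\<rho>, v, B, p)"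
    by (auto simp: primitive_states_def)
  have U': "U = (\<rho> * lorentz v, (\<rho> * enthalpy \<Gamma> \<rho> p * (lorentz v)\<^sup>2) *\<^sub>R v
      + ((norm B)\<^sup>2 *\<^sub>R v - (v \<bullet> B) *\<^sub>R B), B,
      \<rho> * enthalpy \<Gamma> \<rho> p * (lorentz v)\<^sup>2 - p_total v B p + (norm B)\<^sup>2)"
    by (simp add: U conservative_def Let_def)
  show ?thesis
  proof (rule that[OF pos refl refl U'])
    fix k
    show "flux \<Gamma> k U = (\<rho> * lorentz v * v $ k,
       v $ k *\<^sub>R ((\<rho> * enthalpy \<Gamma> \<rho> p * (lorentz v)\<^sup>2) *\<^sub>R v
         + ((norm B)\<^sup>2 *\<^sub>R v - (v \<bullet> B) *\<^sub>R B))
         - B $ k *\<^sub>R ((1 - (norm v)\<^sup>2) *\<^sub>R B + (v \<bullet> B) *\<^sub>R v) + p_total v B p *\<^sub>R axis k 1,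
       v $ k *\<^sub>R B - B $ k *\<^sub>R v,
       ((\<rho> * enthalpy \<Gamma> \<rho> p * (lorentz v)\<^sup>2) *\<^sub>R v
         + ((norm B)\<^sup>2 *\<^sub>R v - (v \<bullet> B) *\<^sub>R B)) $ k)"
      unfolding flux_def P by (simp add: U' inverse_lorentz_square[OF pos(3)])
  qed
qed

text \<open>The strict sign comes from the fluid. It makes the scheme stay inside the admissible set,
and not merely its closure, even if the CFL condition holds with equality and there are no inner
Lobatto nodes.\<close>

lemma flux_splitting:
  fixes u C :: "real^3" and \<sigma> :: real
  assumes \<Gamma>: "1 < \<Gamma>" "\<Gamma> \<le> 2" and U: "U \<in> admissible \<Gamma>"
    and \<sigma>: "\<sigma> \<in> {1, -1}" and u: "norm u < 1"
  shows "0 < U \<bullet> lorentz_normal u C + p_mag u C + \<sigma> * (flux \<Gamma> k U \<bullet> lorentz_normal u C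
    + (u $ k * p_mag u C - magnetic U $ k * (u \<bullet> C)))"
proof -
  obtain \<rho> v B p H M where pos: "\<rho> > 0" "p > 0" "norm v < 1"
    and H: "H = \<rho> * enthalpy \<Gamma> \<rho> p * (lorentz v)\<^sup>2"
    and M: "M = (norm B)\<^sup>2 *\<^sub>R v - (v \<bullet> B) *\<^sub>R B"
    and U: "U = (\<rho> * lorentz v, H *\<^sub>R v + M, B, H - p_total v B p + (norm B)\<^sup>2)"
    and F: "\<And>k. flux \<Gamma> k U = (\<rho> * lorentz v * v $ k,
       v $ k *\<^sub>R (H *\<^sub>R v + M) - B $ k *\<^sub>R ((1 - (norm v)\<^sup>2) *\<^sub>R B + (v \<bullet> B) *\<^sub>R v)
         + p_total v B p *\<^sub>R axis k 1,
       v $ k *\<^sub>R B - B $ k *\<^sub>R v, (H *\<^sub>R v + M) $ k)"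
    using admissible_flux[OF U] by metis
  define c where "c = (1 - (norm u)\<^sup>2) *\<^sub>R C + (u \<bullet> C) *\<^sub>R u"
  define N where "N = (1 - (norm v)\<^sup>2) *\<^sub>R B + (v \<bullet> B) *\<^sub>R v"
  have "0 < (1 + \<sigma> *\<^sub>R axis k 1 \<bullet> v) * (H * (1 - v \<bullet> u) - \<rho> * lorentz v * sqrt (1 - (norm u)\<^sup>2))
           - p * (1 + \<sigma> *\<^sub>R axis k 1 \<bullet> u)"
    unfolding H using \<sigma> by (intro fluid_splitting pos u \<Gamma>) (auto simp: norm_axis_1)
  also have "\<dots> = (1 + \<sigma> * v $ k) * (H * (1 - v \<bullet> u) - \<rho> * lorentz v * sqrt (1 - (norm u)\<^sup>2))
           - p * (1 + \<sigma> * u $ k)"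
    by (simp add: inner_axis')
  finally have fluid: "0 < \<dots>" .
  note mag = magnetic_splitting[OF \<sigma> pos(3) u M N_def c_def, of k]
  show ?thesis
    unfolding F lorentz_normal_def N_def[symmetric] c_def[symmetric]
    unfolding U
    using add_pos_nonneg[OF fluid mag]
    by (simp add: magnetic_def p_total_def inner_diff_left inner_add_left inner_axis' algebra_simps)
qed

lemma density_splitting:
  fixes \<sigma> :: real
  assumes U: "U \<in> admissible \<Gamma>" and \<sigma>: "\<sigma> \<in> {1, -1}"
  shows "0 < fst U + \<sigma> * fst (flux \<Gamma> k U)"
proof -
  obtain \<rho> v B p H M where pos: "\<rho> > 0" "p > 0" "norm v < 1"
    and "U = (\<rho> * lorentz v, H *\<^sub>R v + M, B, H - p_total v B p + (norm B)\<^sup>2)"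
    and "\<And>k. flux \<Gamma> k U = (\<rho> * lorentz v * v $ k,
       v $ k *\<^sub>R (H *\<^sub>R v + M) - B $ k *\<^sub>R ((1 - (norm v)\<^sup>2) *\<^sub>R B + (v \<bullet> B) *\<^sub>R v)
         + p_total v B p *\<^sub>R axis k 1,
       v $ k *\<^sub>R B - B $ k *\<^sub>R v, (H *\<^sub>R v + M) $ k)"
    using admissible_flux[OF U] by metis
  then have "fst U + \<sigma> * fst (flux \<Gamma> k U) = \<rho> * lorentz v * (1 + \<sigma> * v $ k)"
    by (simp add: algebra_simps)
  moreover have "0 < lorentz v"
    using norm_less_1_square[OF pos(3)] by (simp add: lorentz_def)
  moreover have "\<bar>v $ k\<bar> < 1" using component_le_norm_cart[of v k] pos(3) by linarith
  then have "0 < 1 + \<sigma> * v $ k" using \<sigma> by auto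
  ultimately show ?thesis using pos by simp
qed

section \<open>Recovery of admissible states from linear inequalities\<close>

text \<open>For given \<open>H = \<rho> h W\<^sup>2 > 0\<close> the momentum equation determines the velocity \<open>v H\<close>, and the
mass and enthalpy equations determine the pressure \<open>P H\<close>; the remaining energy equation is \<open>f H
= E\<close>. The squared speed decreases with \<open>H\<close>, so \<open>P\<close> is positive beyond the point \<open>H0\<close> at which it
vanishes. There \<open>f H0 < E\<close> is the assumption for \<open>u = v H0\<close> and \<open>C = B\<close>, while \<open>f H \<ge> H / 2\<close> for
larger \<open>H\<close>.\<close>

lemma admissibleI:
  fixes m B :: "real^3"
  assumes \<Gamma>: "1 < \<Gamma>" "\<Gamma> \<le> 2" and D: "0 < D"
    and pos: "\<And>u C. norm u < 1 \<Longrightarrow> 0 < (D, m, B, E) \<bullet> lorentz_normal u C + p_mag u C"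
  shows "(D, m, B, E) \<in> admissible \<Gamma>"
proof -
  define b c where "b = (norm B)\<^sup>2" and "c = m \<bullet> B"
  have b: "0 \<le> b" "b = B \<bullet> B" by (simp_all add: b_def power2_norm_eq_inner)
  define v where "v H = (1 / (H + b)) *\<^sub>R (m + (c / H) *\<^sub>R B)" for H
  define w where "w H = 1 - (norm (v H))\<^sup>2" for H
  have vB: "v H \<bullet> B = c / H" if "H > 0" for H
  proof -
    have "v H \<bullet> B = (c + c / H * b) / (H + b)"
      by (simp add: v_def inner_add_left c_def b(2))
    also have "c + c / H * b = c / H * (H + b)" using that by (simp add: field_simps)
    finally show ?thesis using that b by simp
  qed
  have m: "m = H *\<^sub>R v H + (b *\<^sub>R v H - (v H \<bullet> B) *\<^sub>R B)" if "H > 0" for H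
  proof -
    have "H *\<^sub>R v H + b *\<^sub>R v H = (H + b) *\<^sub>R v H" by (simp add: scaleR_add_left)
    also have "\<dots> = m + (c / H) *\<^sub>R B" using that b(1) by (simp add: v_def)
    finally show ?thesis using vB[OF that] by (simp add: algebra_simps)
  qed
  have norm_v: "(norm (v H))\<^sup>2 = ((norm m)\<^sup>2 + 2 * c\<^sup>2 / H + c\<^sup>2 * b / H\<^sup>2) / (H + b)\<^sup>2"
    if "H > 0" for H
  proof -
    have "(norm (m + (c / H) *\<^sub>R B))\<^sup>2 = (norm m)\<^sup>2 + 2 * (c / H) * c + (c / H)\<^sup>2 * b"
      unfolding power2_norm_eq_inner c_def b(2)
      by (simp add: inner_add inner_commute[of B m] power2_eq_square algebra_simps)
    then show ?thesis
      by (simp add: v_def power_mult_distrib power_divide power2_eq_square)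
  qed
  have w_mono: "w H \<le> w H'" if "0 < H" "H \<le> H'" for H H'
    using that b(1) unfolding w_def
    by (subst (1 2) norm_v)
      (auto intro!: frac_le add_mono divide_left_mono power_mono mult_pos_pos add_pos_nonneg)
  have cont_v: "continuous_on {0<..} v"
    unfolding v_def using b(1) by (intro continuous_intros) auto
  have cont_w: "continuous_on {0<..} w"
    unfolding w_def by (intro continuous_intros cont_v)
  define A where "A = (norm m)\<^sup>2 + 2 * c\<^sup>2 + c\<^sup>2 * b"
  have A: "0 \<le> A" using b(1) by (simp add: A_def)
  define hi where "hi = 1 + D + A + D\<^sup>2"
  have hi: "1 \<le> hi" "D \<le> hi" "A + D\<^sup>2 \<le> hi" using A D by (simp_all add: hi_def)
  \<comment> \<open>\<open>H0\<close> is a root of \<open>H * sqrt (w H) = D\<close>; as \<open>D > 0\<close>, the speed is below 1 there\<close>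
  have "\<exists>H\<ge>D. H \<le> hi \<and> H\<^sup>2 * w H = D\<^sup>2"
  proof (rule IVT')
    show "D\<^sup>2 * w D \<le> D\<^sup>2" by (simp add: w_def mult_left_le)
    have shrink: "x / y \<le> x" if "0 \<le> x" "1 \<le> y" for x y :: real
      using divide_left_mono[of 1 y x] that by simp
    have "(norm (v hi))\<^sup>2 \<le> A / hi\<^sup>2"
      unfolding norm_v[OF less_le_trans[OF zero_less_one hi(1)]] A_def
      using hi(1) b(1) by (intro frac_le add_mono power_mono shrink order_refl) auto
    then have "hi\<^sup>2 * w hi \<ge> hi\<^sup>2 * (1 - A / hi\<^sup>2)"
      unfolding w_def by (intro mult_left_mono) auto
    moreover have "hi\<^sup>2 * (1 - A / hi\<^sup>2) = hi\<^sup>2 - A" using hi(1) by (simp add: field_simps)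
    moreover have "hi \<le> hi\<^sup>2" using hi(1) by (simp add: power2_eq_square)
    ultimately show "D\<^sup>2 \<le> hi\<^sup>2 * w hi" using hi(3) by linarith
    show "continuous_on {D..hi} (\<lambda>H. H\<^sup>2 * w H)"
      using D by (intro continuous_intros continuous_on_subset[OF cont_w]) auto
  qed (rule hi(2))
  then obtain H0 where H0: "D \<le> H0" "H0\<^sup>2 * w H0 = D\<^sup>2" by blast
  have H0_pos: "0 < H0" using D H0 by simp
  have w0: "0 < w H0" using H0(2) D H0_pos by (metis zero_less_mult_pos zero_less_power)
  have v_less: "norm (v H) < 1" if "0 < w H" for H
    using that unfolding w_def by (simp add: abs_square_less_1)
  define P where "P H = (\<Gamma> - 1) / \<Gamma> * (H * w H - D * sqrt (w H))" for H
  define R where "R H = (w H * b + (c / H)\<^sup>2) / 2" for H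
  have R: "R H = p_mag (v H) B" if "0 < w H" "0 < H" for H
    using p_mag_eq[OF v_less[OF that(1)], of B] vB[OF that(2)] by (simp add: R_def w_def b_def)
  define f where "f H = H - P H - R H + b" for H
  \<comment> \<open>the hypothesis at the pressureless state reads \<open>0 < E - f H0\<close>\<close>
  have "f H0 < E"
  proof -
    have "H0 * sqrt (w H0) = D"
      using H0(2) D H0_pos w0
      by (metis real_sqrt_mult real_sqrt_pow2 real_sqrt_unique abs_of_pos less_imp_le real_sqrt_abs)
    then have Dw: "D * sqrt (w H0) = H0 * w H0" using w0 by auto
    have mv: "m \<bullet> v H0 = H0 * (1 - w H0) + (b * (1 - w H0) - (v H0 \<bullet> B)\<^sup>2)"
      unfolding w_def power2_norm_eq_inner
      by (subst m[OF H0_pos]) (simp add: inner_add_left inner_diff_left inner_commute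
          power2_eq_square algebra_simps)
    have "0 < (D, m, B, E) \<bullet> lorentz_normal (v H0) B + p_mag (v H0) B"
      by (rule pos[OF v_less[OF w0]])
    also have "\<dots> = - D * sqrt (w H0) - m \<bullet> v H0 - (w H0 * b + (v H0 \<bullet> B)\<^sup>2) + E + R H0"
      unfolding R[OF w0 H0_pos] lorentz_normal_def w_def[of H0, symmetric]
      by (simp add: b(2) inner_add_right inner_commute power2_eq_square algebra_simps)
    also have "\<dots> = E - f H0"
      unfolding mv f_def P_def Dw using Dw by (simp add: R_def algebra_simps flip: vB[OF H0_pos])
    finally show ?thesis by simp
  qed
  define top where "top = H0 + 2 * \<bar>E\<bar>"
  have w_pos: "0 < w H" if "H0 \<le> H" for H using w_mono[OF H0_pos that] w0 by simp
  have "\<exists>H\<ge>H0. H \<le> top \<and> f H = E"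
  proof (rule IVT')
    show "f H0 \<le> E" using \<open>f H0 < E\<close> by simp
    have t: "H0 \<le> top" "0 < top" using H0_pos by (simp_all add: top_def)
    have w: "0 < w top" "w top \<le> 1" using w_pos[OF t(1)] by (simp_all add: w_def)
    have "(\<Gamma> - 1) / \<Gamma> \<le> 1 / 2" using \<Gamma> by (simp add: field_simps)
    moreover have "top * w top - D * sqrt (w top) \<le> top"
      using w t D by (smt (verit) mult_left_le mult_nonneg_nonneg real_sqrt_ge_zero)
    moreover have "0 \<le> (\<Gamma> - 1) / \<Gamma>" using \<Gamma> by simp
    ultimately have "P top \<le> 1 / 2 * top"
      unfolding P_def using t by (smt (verit) mult_left_mono mult_right_mono)
    moreover have "R top \<le> b / 2"
    proof -
      have "(c / top)\<^sup>2 \<le> (norm (v top))\<^sup>2 * b"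
        using Cauchy_Schwarz_ineq[of "v top" B] vB[OF t(2)] by (simp add: b power2_norm_eq_inner)
      then show ?thesis by (simp add: R_def w_def algebra_simps)
    qed
    moreover have "E \<le> 1 / 2 * top" using H0_pos by (simp add: top_def)
    ultimately show "E \<le> f top" using b(1) unfolding f_def by linarith
    show "continuous_on {H0..top} f"
      unfolding f_def P_def R_def using H0_pos
      by (intro continuous_intros continuous_on_subset[OF cont_w]) auto
  qed (simp add: top_def)
  then obtain H where H: "H0 \<le> H" "f H = E" by blast
  have "H \<noteq> H0" using H \<open>f H0 < E\<close> by auto
  then have H_gt: "H0 < H" "0 < H" using H H0_pos by simp_all
  have wH: "0 < w H" using w_pos H by simp
  define s where "s = sqrt (w H)"
  have s: "0 < s" "s * s = w H" using wH by (simp_all add: s_def)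
  have "D\<^sup>2 < (H * s)\<^sup>2"
  proof -
    have "D\<^sup>2 = H0\<^sup>2 * w H0" using H0 by simp
    also have "\<dots> \<le> H0\<^sup>2 * w H" using w_mono[OF H0_pos H(1)] by (intro mult_left_mono) auto
    also have "\<dots> < H\<^sup>2 * w H" using H_gt H0_pos wH by (intro mult_strict_right_mono power_strict_mono) auto
    finally show ?thesis using s by (simp add: power2_eq_square mult_ac)
  qed
  then have "D < H * s" using s H_gt by (simp add: power2_less_imp_less)
  then have "0 < (\<Gamma> - 1) / \<Gamma> * (s * (H * s - D))" using s \<Gamma> by simp
  also have "\<dots> = P H" unfolding P_def s_def[symmetric] unfolding s(2)[symmetric] using s by (simp add: algebra_simps)
  finally have P: "0 < P H" .
  have v: "norm (v H) < 1" by (rule v_less[OF wH])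
  have W: "lorentz (v H) = 1 / s" by (simp add: lorentz_def s_def w_def)
  have Ds: "0 < D * s" using D s by simp
  have "(D * s) * enthalpy \<Gamma> (D * s) (P H) = H * w H"
    unfolding enthalpy_eq[OF Ds \<Gamma>(1)] P_def using \<Gamma> by (simp add: s_def)
  also have "\<dots> = H * s\<^sup>2" using s(2) by (simp add: power2_eq_square)
  finally have hyd: "(D * s) * enthalpy \<Gamma> (D * s) (P H) * (lorentz (v H))\<^sup>2 = H"
    using s(1) unfolding W by (simp add: power_divide)
  have "D * s * lorentz (v H) = D" using s by (simp add: W)
  moreover have "H *\<^sub>R v H + (norm B)\<^sup>2 *\<^sub>R v H - (v H \<bullet> B) *\<^sub>R B = m"
    using m[OF H_gt(2), symmetric] by (simp only: b_def add_diff_eq)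
  moreover have "H - p_total (v H) B (P H) + (norm B)\<^sup>2 = E"
    using H(2) R[OF wH H_gt(2)] by (simp add: f_def b_def p_total_def)
  ultimately have "conservative \<Gamma> (D * s, v H, B, P H) = (D, m, B, E)"
    by (simp only: conservative_def Let_def prod.case hyd)
  moreover have "(D * s, v H, B, P H) \<in> primitive_states"
    using Ds P v by (simp add: primitive_states_def)
  ultimately show ?thesis unfolding admissible_def by (metis image_eqI)
qed

section \<open>Interpolatory quadrature\<close>

definition mean_value :: "real poly \<Rightarrow> real" where
  "mean_value p = integral {-1..1} (poly p) / 2"

lemma poly_integrable: "poly p integrable_on {a..b :: real}"
  by (intro integrable_continuous_interval continuous_intros)

lemma poly_fun:
  "poly (p + q) = (\<lambda>t. poly p t + poly q t)"
  "poly (smult c p) = (\<lambda>t. c * poly p t)"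
  "poly 0 = (\<lambda>t. 0)"
  "poly 1 = (\<lambda>t. 1)"
  by (rule ext, simp)+

lemma mean_value_add: "mean_value (p + q) = mean_value p + mean_value q"
  by (simp add: mean_value_def poly_fun integral_add poly_integrable add_divide_distrib)

lemma mean_value_smult: "mean_value (smult c p) = c * mean_value p"
  by (simp add: mean_value_def poly_fun)

lemma mean_value_0 [simp]: "mean_value 0 = 0"
  by (simp add: mean_value_def poly_fun)

lemma mean_value_sum: "mean_value (sum f A) = (\<Sum>a\<in>A. mean_value (f a))"
  by (induction A rule: infinite_finite_induct) (simp_all add: mean_value_add)

lemma mean_value_1 [simp]: "mean_value 1 = 1"
  by (simp add: mean_value_def poly_fun)

lemma mean_value_pderiv: "mean_value (pderiv p) = (poly p 1 - poly p (-1)) / 2"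
proof -
  have "(poly (pderiv p) has_integral (poly p 1 - poly p (-1))) {-1..1}"
    by (rule fundamental_theorem_of_calculus)
       (auto intro: has_field_derivative_at_within poly_DERIV
         simp: has_real_derivative_iff_has_vector_derivative[symmetric])
  then show ?thesis by (simp add: mean_value_def integral_unique)
qed

lemma mean_value_reflect: "mean_value (pcompose p [:0, -1:]) = mean_value p"
proof -
  have "poly (pcompose p [:0, -1:]) = (\<lambda>x. poly p (- x))"
    by (rule ext) (simp add: poly_pcompose)
  moreover have "integral {-1..1} (\<lambda>x. poly p (- x)) = integral {-1..1} (poly p)"
    using Henstock_Kurzweil_Integration.integral_reflect_real[of 1 "-1" "poly p"] by simp
  ultimately show ?thesis by (simp add: mean_value_def)
qed

lemma mean_value_pos:
  assumes nonneg: "\<And>t. t \<in> {-1..1} \<Longrightarrow> 0 \<le> poly p t" and "p \<noteq> 0"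
  shows "0 < mean_value p"
proof -
  have "0 \<le> integral {-1..1} (poly p)" by (rule integral_nonneg) (auto simp: poly_integrable nonneg)
  moreover have "integral {-1..1} (poly p) \<noteq> 0"
  proof
    assume "integral {-1..1} (poly p) = 0"
    then have "{-1..1} \<subseteq> {t. poly p t = 0}"
      using integral_eq_0_iff[of "-1" 1 "poly p"] nonneg
      by (auto simp: continuous_on_poly[OF continuous_on_id])
    then have "finite {-1..1 :: real}" using poly_roots_finite[OF \<open>p \<noteq> 0\<close>] finite_subset by blast
    then show False by (simp add: infinite_Icc)
  qed
  ultimately show ?thesis by (simp add: mean_value_def)
qed

definition exact_to_degree :: "nat \<Rightarrow> (nat \<Rightarrow> real) \<Rightarrow> (nat \<Rightarrow> real) \<Rightarrow> nat \<Rightarrow> bool" where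
  "exact_to_degree n \<xi> w d \<longleftrightarrow>
     (\<forall>p :: real poly. degree p \<le> d \<longrightarrow> mean_value p = (\<Sum>b=1..n. w b * poly p (\<xi> b)))"

lemma exact_to_degreeD:
  "exact_to_degree n \<xi> w d \<Longrightarrow> degree p \<le> d \<Longrightarrow> mean_value p = (\<Sum>b=1..n. w b * poly p (\<xi> b))"
  by (simp add: exact_to_degree_def)

lemma exact_to_degree_mono: "exact_to_degree n \<xi> w d \<Longrightarrow> d' \<le> d \<Longrightarrow> exact_to_degree n \<xi> w d'"
  by (auto simp: exact_to_degree_def)

definition node_poly :: "(nat \<Rightarrow> real) \<Rightarrow> nat set \<Rightarrow> real poly" where
  "node_poly \<xi> A = (\<Prod>c\<in>A. [:- \<xi> c, 1:])"

lemma poly_node_poly: "poly (node_poly \<xi> A) t = (\<Prod>c\<in>A. t - \<xi> c)"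
  by (simp add: node_poly_def poly_prod)

lemma degree_node_poly: "degree (node_poly \<xi> A) = card A"
  unfolding node_poly_def by (subst degree_prod_sum_eq) auto

lemma node_poly_neq_0 [simp]: "node_poly \<xi> A \<noteq> 0"
  by (cases "finite A") (auto simp: node_poly_def)

lemma interpolatory_weight_eq:
  "interpolatory_weight n \<xi> b =
     mean_value (node_poly \<xi> ({1..n} - {b})) / poly (node_poly \<xi> ({1..n} - {b})) (\<xi> b)"
  by (simp add: interpolatory_weight_def mean_value_def poly_node_poly[abs_def] prod_dividef)

lemma interpolatory_exact_below:
  assumes inj: "inj_on \<xi> {1..n}" and p: "degree p < n"
  shows "mean_value p = (\<Sum>b=1..n. interpolatory_weight n \<xi> b * poly p (\<xi> b))"
proof -
  define l where "l b = node_poly \<xi> ({1..n} - {b})" for b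
  define q where "q = (\<Sum>b=1..n. smult (poly p (\<xi> b) / poly (l b) (\<xi> b)) (l b))"
  have l_eq: "poly (l b) (\<xi> b') = 0 \<longleftrightarrow> b \<noteq> b'" if "b \<in> {1..n}" "b' \<in> {1..n}" for b b'
    using inj that by (auto simp: l_def poly_node_poly inj_on_eq_iff)
  have "p = q"
  proof (rule poly_eqI_degree[of "\<xi> ` {1..n}"])
    fix x assume "x \<in> \<xi> ` {1..n}"
    then obtain a where a: "a \<in> {1..n}" "x = \<xi> a" by blast
    have "poly q x = (\<Sum>b=1..n. if b = a then poly p (\<xi> a) else 0)"
      unfolding q_def poly_sum a(2) using a(1) by (intro sum.cong) (auto simp: l_eq)
    then show "poly p x = poly q x" using a by simp
  next
    have card: "card (\<xi> ` {1..n}) = n" using inj by (simp add: card_image)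
    show "degree p < card (\<xi> ` {1..n})" using p card by simp
    have "degree q \<le> n - 1" unfolding q_def
      by (intro degree_sum_le) (auto simp: l_def degree_node_poly intro: order.trans[OF degree_smult_le])
    then show "degree q < card (\<xi> ` {1..n})" using p card by simp
  qed
  then have "mean_value p = (\<Sum>b=1..n. poly p (\<xi> b) / poly (l b) (\<xi> b) * mean_value (l b))"
    by (metis (no_types, lifting) q_def mean_value_sum mean_value_smult sum.cong)
  then show ?thesis by (simp add: interpolatory_weight_eq l_def mult.commute)
qed

text \<open>Division with remainder by the node polynomial: the remainder is interpolated exactly and
the multiple of the node polynomial vanishes at the nodes, so all that counts is its integral.\<close>

lemma interpolatory_exact:
  assumes inj: "inj_on \<xi> {1..n}" and w: "\<And>b. b \<in> {1..n} \<Longrightarrow> w b = interpolatory_weight n \<xi> b"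
    and orth: "\<And>r. r = 0 \<or> degree r < m \<Longrightarrow> mean_value (node_poly \<xi> {1..n} * r) = 0"
    and nm: "0 < n + m"
  shows "exact_to_degree n \<xi> w (n + m - 1)"
  unfolding exact_to_degree_def
proof (intro allI impI)
  fix p :: "real poly" assume p: "degree p \<le> n + m - 1"
  define N where "N = node_poly \<xi> {1..n}"
  have N: "degree N = n" by (simp add: N_def degree_node_poly)
  have "p div N = 0 \<or> degree (p div N) < m"
  proof (cases "p div N = 0")
    case q: False
    have "degree (p mod N) \<le> n + m - 1"
      using degree_mod_less[of N p] N nm by (auto simp: N_def)
    then have "degree (p - p mod N) \<le> n + m - 1" using p by (intro degree_diff_le)
    also have "p - p mod N = N * (p div N)" by (simp add: minus_mod_eq_mult_div)
    also have "degree \<dots> = n + degree (p div N)" using q N by (subst degree_mult_eq) (auto simp: N_def)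
    finally show ?thesis using nm by linarith
  qed simp
  then have "mean_value (N * (p div N)) = 0" unfolding N_def by (rule orth)
  then have "mean_value p = mean_value (p mod N)"
    using mean_value_add[of "N * (p div N)" "p mod N"] by simp
  also have "\<dots> = (\<Sum>b=1..n. interpolatory_weight n \<xi> b * poly (p mod N) (\<xi> b))"
  proof (cases "n = 0")
    case True
    then have "N = 1" by (simp add: N_def node_poly_def)
    then show ?thesis using True by simp
  next
    case False
    then have "degree (p mod N) < n"
      using degree_mod_less[of N p] N by (auto simp: N_def)
    then show ?thesis by (rule interpolatory_exact_below[OF inj])
  qed
  also have "\<dots> = (\<Sum>b=1..n. w b * poly p (\<xi> b))"
  proof (intro sum.cong refl)
    fix b assume b: "b \<in> {1..n}"
    then have "poly N (\<xi> b) = 0" by (auto simp: N_def poly_node_poly)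
    then have "poly p (\<xi> b) = poly (p mod N) (\<xi> b)"
      by (metis add_0 div_mult_mod_eq mult_zero_right poly_add poly_mult)
    then show "interpolatory_weight n \<xi> b * poly (p mod N) (\<xi> b) = w b * poly p (\<xi> b)"
      using w[OF b] by simp
  qed
  finally show "mean_value p = (\<Sum>b=1..n. w b * poly p (\<xi> b))" .
qed

lemma eq_smult_node_poly:
  assumes inj: "inj_on \<xi> {1..n}" and deg: "degree p \<le> n"
    and zero: "\<And>b. b \<in> {1..n} \<Longrightarrow> poly p (\<xi> b) = 0"
  shows "p = smult (coeff p n) (node_poly \<xi> {1..n})"
proof (rule poly_eqI_degree_lead_coeff[of _ n _ "\<xi> ` {1..n}"])
  have "lead_coeff (node_poly \<xi> {1..n}) = 1" by (simp add: node_poly_def lead_coeff_prod)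
  then show "coeff p n = coeff (smult (coeff p n) (node_poly \<xi> {1..n})) n"
    by (simp add: degree_node_poly)
  show "n \<le> card (\<xi> ` {1..n})" using inj by (simp add: card_image)
  show "degree (smult (coeff p n) (node_poly \<xi> {1..n})) \<le> n"
    using degree_smult_le[of "coeff p n" "node_poly \<xi> {1..n}"] by (simp add: degree_node_poly)
  fix z assume "z \<in> \<xi> ` {1..n}"
  then obtain b where "b \<in> {1..n}" "z = \<xi> b" by blast
  then show "poly p z = poly (smult (coeff p n) (node_poly \<xi> {1..n})) z"
    using zero by (auto simp: poly_node_poly intro!: prod_zero)
qed (rule deg)

text \<open>Transfers orthogonality from a polynomial known by another formula (Legendre's, or the
one that belongs to the Lobatto nodes) to the node polynomial, which has the same zeros.\<close>

lemma orthogonal_node_poly: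
  assumes inj: "inj_on \<xi> {1..n}" and deg: "degree p \<le> n" and p: "p \<noteq> 0"
    and zero: "\<And>b. b \<in> {1..n} \<Longrightarrow> poly p (\<xi> b) = 0"
    and orth: "mean_value (p * r) = 0"
  shows "mean_value (node_poly \<xi> {1..n} * r) = 0"
proof -
  have eq: "p = smult (coeff p n) (node_poly \<xi> {1..n})"
    by (rule eq_smult_node_poly[OF inj deg zero])
  then have "coeff p n \<noteq> 0" using p by auto
  moreover have "coeff p n * mean_value (node_poly \<xi> {1..n} * r) = 0"
    using orth by (subst (asm) eq) (simp add: mean_value_smult)
  ultimately show ?thesis by simp
qed

section \<open>Gauss--Legendre and Gauss--Lobatto rules\<close>

lemma degree_legendre: "degree (legendre n) = n"
proof -
  have "degree ((pderiv ^^ k) p) = degree p - k" for k and p :: "real poly"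
    by (induction k) (simp_all add: degree_pderiv)
  moreover have "degree ([:-1, 0, 1 :: real:] ^ n) = 2 * n"
    by (simp add: degree_power_eq)
  ultimately show ?thesis by (simp add: legendre_def)
qed

lemma power_dvd_pderiv:
  fixes p q :: "real poly"
  shows "p ^ Suc k dvd q \<Longrightarrow> p ^ k dvd pderiv q"
  by (elim dvdE, simp only: pderiv_mult pderiv_power_Suc)
    (intro dvd_add dvd_mult2[OF le_imp_power_dvd] dvd_mult dvd_mult2 dvd_smult; simp)

text \<open>Integration by parts in Rodrigues' formula. The boundary terms vanish because the
derivatives of \<open>(t\<^sup>2 - 1) ^ n\<close> of order less than \<open>n\<close> still contain the factor \<open>t\<^sup>2 - 1\<close>.\<close>

lemma legendre_orthogonal:
  assumes "r = 0 \<or> degree r < n"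
  shows "mean_value (legendre n * r) = 0"
proof -
  let ?Y = "[:-1, 0, 1:] ^ n :: real poly"
  have dvd: "[:-1, 0, 1:] ^ (n - j) dvd (pderiv ^^ j) ?Y" if "j \<le> n" for j
    using that
  proof (induction j)
    case (Suc j)
    then show ?case using power_dvd_pderiv[of "[:-1, 0, 1:]" "n - Suc j" "(pderiv ^^ j) ?Y"]
      by (simp add: Suc_diff_Suc)
  qed simp
  have "mean_value ((pderiv ^^ j) ?Y * r) = 0" if "j \<le> n" "r = 0 \<or> degree r < j" for j r
    using that
  proof (induction j arbitrary: r)
    case (Suc j)
    let ?A = "(pderiv ^^ j) ?Y"
    have "[:-1, 0, 1:] dvd ?A"
      using Suc.prems(1) by (intro dvd_trans[OF dvd_power dvd]) auto
    then obtain k where k: "?A = [:-1, 0, 1:] * k" by (elim dvdE)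
    have A: "poly ?A 1 = 0" "poly ?A (-1) = 0" unfolding k by simp_all
    have "pderiv r = 0 \<or> degree (pderiv r) < j"
      using Suc.prems(2) by (cases "degree r") (auto simp: degree_pderiv pderiv_eq_0_iff)
    then have "mean_value (?A * pderiv r) = 0" using Suc.IH Suc.prems(1) by simp
    moreover have "mean_value (pderiv (?A * r)) = 0"
      using A by (simp add: mean_value_pderiv)
    ultimately show ?case by (simp add: pderiv_mult mean_value_add mult.commute)
  qed auto
  from this[of n r] assms show ?thesis
    by (simp add: legendre_def mean_value_smult)
qed

text \<open>The derivative of a Legendre polynomial is even or odd. This is the symmetry which makes
the two end point weights of the Lobatto rule equal.\<close>

lemma poly_pderiv_legendre_minus_square:
  "(poly (pderiv (legendre n)) (- t))\<^sup>2 = (poly (pderiv (legendre n)) t)\<^sup>2"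
proof -
  let ?s = "\<lambda>p :: real poly. pcompose p [:0, -1:]"
  have der: "?s ((pderiv ^^ k) p) = smult ((-1) ^ k) ((pderiv ^^ k) (?s p))" for k p
  proof (induction k)
    case (Suc k)
    have "pderiv (?s q) = - ?s (pderiv q)" for q by (simp add: pderiv_pcompose pderiv_pCons)
    then have "?s (pderiv q) = - pderiv (?s q)" for q by simp
    then show ?case using Suc by (simp add: pderiv_smult)
  qed simp
  have "?s (q ^ n) = ?s q ^ n" for q
    by (induction n) (simp_all only: power_0 power_Suc pcompose_mult pcompose_1)
  then have "?s ([:-1, 0, 1:] ^ n) = [:-1, 0, 1:] ^ n"
    by (simp add: pcompose_pCons)
  then have "?s (pderiv (legendre n)) = smult ((-1) ^ Suc n) (pderiv (legendre n))"
    using der[of "Suc n" "[:-1, 0, 1:] ^ n"] by (simp add: legendre_def pderiv_smult pcompose_smult)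
  then have "poly (?s (pderiv (legendre n))) t = poly (smult ((-1) ^ Suc n) (pderiv (legendre n))) t"
    by (rule arg_cong)
  then have "poly (pderiv (legendre n)) (- t) = (-1) ^ Suc n * poly (pderiv (legendre n)) t"
    by (simp only: poly_pcompose poly_smult) simp
  then show ?thesis by (simp add: power_mult_distrib power_even_eq[symmetric] flip: power_mult)
qed

text \<open>An exact rule integrates a nonnegative polynomial that vanishes at all nodes but one to a
multiple of the weight at this node.\<close>

lemma weight_pos:
  assumes exact: "exact_to_degree n \<xi> w d" and b: "b \<in> {1..n}" and deg: "degree p \<le> d"
    and p: "p \<noteq> 0" and nonneg: "\<And>t. t \<in> {-1..1} \<Longrightarrow> 0 \<le> poly p t" and at_b: "0 \<le> poly p (\<xi> b)"
    and others: "\<And>a. a \<in> {1..n} - {b} \<Longrightarrow> poly p (\<xi> a) = 0"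
  shows "mean_value p = w b * poly p (\<xi> b) \<and> 0 < w b"
proof -
  have "mean_value p = (\<Sum>a=1..n. w a * poly p (\<xi> a))" by (rule exact_to_degreeD[OF exact deg])
  also have "\<dots> = (\<Sum>a\<in>{b}. w a * poly p (\<xi> a))"
    using b others by (intro sum.mono_neutral_right) auto
  finally have eq: "mean_value p = w b * poly p (\<xi> b)" by simp
  have "0 < mean_value p" by (rule mean_value_pos[OF nonneg p])
  then have "0 < w b" using at_b unfolding eq by (simp add: zero_less_mult_iff)
  with eq show ?thesis by blast
qed

lemma gauss_legendre:
  assumes rule: "gauss_legendre_rule n \<xi> w" and n: "1 \<le> n"
  shows "exact_to_degree n \<xi> w (2 * n - 1)" and "\<And>b. b \<in> {1..n} \<Longrightarrow> 0 < w b"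
proof -
  have inj: "inj_on \<xi> {1..n}" and zero: "\<And>b. b \<in> {1..n} \<Longrightarrow> poly (legendre n) (\<xi> b) = 0"
    and w: "\<And>b. b \<in> {1..n} \<Longrightarrow> w b = interpolatory_weight n \<xi> b"
    using rule by (auto simp: gauss_legendre_rule_def bij_betw_def)
  have "legendre n \<noteq> 0" using degree_legendre[of n] n by auto
  then have "mean_value (node_poly \<xi> {1..n} * r) = 0" if "r = 0 \<or> degree r < n" for r
    using that by (intro orthogonal_node_poly[OF inj _ _ zero] legendre_orthogonal)
      (simp_all add: degree_legendre)
  then show exact: "exact_to_degree n \<xi> w (2 * n - 1)"
    using interpolatory_exact[OF inj w, of n] n by (simp add: mult_2)
  fix b assume b: "b \<in> {1..n}"
  show "0 < w b"
  proof (rule conjunct2[OF weight_pos[OF exact b, where p = "(node_poly \<xi> ({1..n} - {b}))\<^sup>2"]])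
    show "degree ((node_poly \<xi> ({1..n} - {b}))\<^sup>2) \<le> 2 * n - 1"
      using b by (simp add: degree_power_eq degree_node_poly)
  qed (auto simp: poly_node_poly)
qed

text \<open>Here \<open>q\<close> is the derivative of the Legendre polynomial and \<open>(1 - t\<^sup>2) q\<close> is the node
polynomial up to a factor. It is orthogonal to all polynomials of degree less than \<open>n - 2\<close>, by
one more integration by parts. The same orthogonality shows that \<open>q\<close> has no zeros outside \<open>[-1,
1]\<close>: a zero \<open>s\<close> there, split off as \<open>q = (t - s) r\<close>, would make the integrand \<open>(1 - t\<^sup>2) q r\<close> of
constant sign, although its integral is zero. Hence \<open>-1\<close> and \<open>1\<close> are the first and the last
node. Their weights are compared through \<open>(1 \<plusminus> t) q\<^sup>2\<close>.\<close>

lemma gauss_lobatto: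
  assumes rule: "gauss_lobatto_rule n \<xi> w" and n: "2 \<le> n"
  shows "exact_to_degree n \<xi> w (2 * n - 3)" and "\<And>b. b \<in> {1..n} \<Longrightarrow> 0 < w b"
    and "\<xi> 1 = -1" and "\<xi> n = 1" and "w n = w 1"
proof -
  define q where "q = pderiv (legendre (n - 1))"
  define Z where "Z = {t. poly q t = 0}"
  have mono: "strict_mono_on {1..n} \<xi>" and nodes: "\<xi> ` {1..n} = {-1, 1} \<union> Z"
    and w: "\<And>b. b \<in> {1..n} \<Longrightarrow> w b = interpolatory_weight n \<xi> b"
    using rule by (auto simp: gauss_lobatto_rule_def q_def Z_def)
  have inj: "inj_on \<xi> {1..n}" by (rule strict_mono_on_imp_inj_on[OF mono])
  have q_deg: "degree q = n - 2" by (simp add: q_def degree_pderiv degree_legendre)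
  have q: "q \<noteq> 0" using n by (simp add: q_def pderiv_eq_0_iff degree_legendre)
  have "card Z \<le> n - 2" using card_poly_roots_bound[OF q] q_deg by (simp add: Z_def)
  moreover have "finite Z" using poly_roots_finite[OF q] by (simp add: Z_def)
  moreover have "card ({-1, 1} \<union> Z) = n" using card_image[OF inj] unfolding nodes by simp
  \<comment> \<open>there are too few zeros for one of them to coincide with an end point\<close>
  ultimately have ends: "1 \<notin> Z" "-1 \<notin> Z"
    using n by (auto simp: insert_absorb card_insert_if split: if_splits)
  have orth: "mean_value ([:1, 0, -1:] * q * r) = 0" if r: "r = 0 \<or> degree r < n - 2" for r
  proof -
    define Y where "Y = [:1, 0, -1:] * r"
    have "pderiv Y = 0 \<or> degree (pderiv Y) < n - 1"
      using r
      by (auto simp: Y_def degree_pderiv simp del: mult_pCons_left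
          intro!: le_less_trans[OF diff_le_mono[OF degree_mult_le]])
    then have "mean_value (legendre (n - 1) * pderiv Y) = 0" by (rule legendre_orthogonal)
    moreover have "mean_value (pderiv (legendre (n - 1) * Y)) = 0"
      by (simp add: mean_value_pderiv Y_def)
    ultimately have "mean_value (Y * q) = 0"
      by (simp only: pderiv_mult mean_value_add q_def[symmetric] add_0)
    then show ?thesis by (simp only: Y_def mult_ac)
  qed
  have inside: "\<bar>s\<bar> \<le> 1" if "s \<in> Z" for s
  proof (rule ccontr)
    assume s: "\<not> \<bar>s\<bar> \<le> 1"
    obtain r where r: "q = [:- s, 1:] * r" using \<open>s \<in> Z\<close> by (auto simp: Z_def poly_eq_0_iff_dvd)
    then have "r \<noteq> 0" using q by auto
    then have "degree r < n - 2" using q_deg unfolding r by (subst (asm) degree_mult_eq) auto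
    then have "mean_value (smult (- s) ([:1, 0, -1:] * q * r)) = 0"
      using orth by (simp only: mean_value_smult) simp
    moreover have "0 < mean_value (smult (- s) ([:1, 0, -1:] * q * r))"
    proof (rule mean_value_pos)
      fix t :: real assume t: "t \<in> {-1..1}"
      have "0 \<le> 1 - t\<^sup>2" using t by (simp add: abs_square_le_1 abs_le_iff)
      moreover have "\<bar>s * t\<bar> \<le> \<bar>s\<bar> * 1" using t unfolding abs_mult by (intro mult_left_mono) auto
      then have "s * t \<le> s\<^sup>2" using s mult_left_mono[of 1 "\<bar>s\<bar>" "\<bar>s\<bar>"] by (simp add: power2_eq_square)
      ultimately have "0 \<le> (1 - t\<^sup>2) * (s\<^sup>2 - s * t) * (poly r t)\<^sup>2" by simp
      also have "\<dots> = poly (smult (- s) ([:1, 0, -1:] * q * r)) t"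
        unfolding r by (simp add: algebra_simps power2_eq_square)
      finally show "0 \<le> poly (smult (- s) ([:1, 0, -1:] * q * r)) t" .
    next
      have "s \<noteq> 0" using s by auto
      then show "smult (- s) ([:1, 0, -1:] * q * r) \<noteq> 0"
        using q \<open>r \<noteq> 0\<close> by (simp del: mult_pCons_left)
    qed
    ultimately show False by simp
  qed
  have node: "\<bar>\<xi> b\<bar> \<le> 1" if "b \<in> {1..n}" for b
  proof -
    have "\<xi> b \<in> {-1, 1} \<union> Z" unfolding nodes[symmetric] using that by (rule imageI)
    then show ?thesis using inside by auto
  qed
  obtain a1 a2 where a: "a1 \<in> {1..n}" "\<xi> a1 = -1" "a2 \<in> {1..n}" "\<xi> a2 = 1"
  proof -
    have "-1 \<in> \<xi> ` {1..n}" "1 \<in> \<xi> ` {1..n}" unfolding nodes by simp_all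
    then show ?thesis using that by (elim imageE) metis
  qed
  have mono': "\<xi> i \<le> \<xi> j" if "i \<le> j" "i \<in> {1..n}" "j \<in> {1..n}" for i j
    using strict_mono_onD[OF mono that(2,3)] that(1) by (cases "i = j") auto
  show first: "\<xi> 1 = -1" using mono'[of 1 a1] node[of 1] a n by auto
  show last: "\<xi> n = 1" using mono'[of a2 n] node[of n] a n by auto
  have interior: "poly q (\<xi> b) = 0" if "b \<in> {1..n} - {1, n}" for b
  proof -
    have "\<xi> b \<noteq> \<xi> 1" "\<xi> b \<noteq> \<xi> n" using inj that n by (auto simp: inj_on_eq_iff)
    moreover have "\<xi> b \<in> {-1, 1} \<union> Z" unfolding nodes[symmetric] using that by (intro imageI) auto
    ultimately show ?thesis using first last by (auto simp: Z_def)
  qed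
  have q_ends: "poly q 1 \<noteq> 0" "poly q (-1) \<noteq> 0" using ends by (auto simp: Z_def)
  have "mean_value (node_poly \<xi> {1..n} * r) = 0" if "r = 0 \<or> degree r < n - 2" for r
  proof (rule orthogonal_node_poly[OF inj])
    show "degree ([:1, 0, -1:] * q) \<le> n"
      using n q_deg by (intro order.trans[OF degree_mult_le]) auto
    show "[:1, 0, -1:] * q \<noteq> 0" using q by (simp del: mult_pCons_left)
    show "poly ([:1, 0, -1:] * q) (\<xi> b) = 0" if "b \<in> {1..n}" for b
      using interior[of b] first last that by (cases "b = 1 \<or> b = n") auto
    show "mean_value ([:1, 0, -1:] * q * r) = 0" by (rule orth) (use that in auto)
  qed
  then have "exact_to_degree n \<xi> w (n + (n - 2) - 1)"
    using n by (intro interpolatory_exact[OF inj w]) auto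
  moreover have "n + (n - 2) - 1 = 2 * n - 3" using n by simp
  ultimately show exact: "exact_to_degree n \<xi> w (2 * n - 3)" by simp
  have deg_end: "degree ([:1, c:] * q\<^sup>2) \<le> 2 * n - 3" for c
    using n q_deg degree_power_eq[OF q, of 2]
    by (intro order.trans[OF degree_mult_le]) auto
  have endpoint: "mean_value ([:1, \<xi> e:] * q\<^sup>2) = w e * poly ([:1, \<xi> e:] * q\<^sup>2) (\<xi> e) \<and> 0 < w e"
    if e: "e = 1 \<or> e = n" for e
  proof (rule weight_pos[OF exact _ deg_end])
    have e1: "\<xi> e = 1 \<or> \<xi> e = -1" using e first last by blast
    have poly_e: "poly ([:1, \<xi> e:] * q\<^sup>2) t = (1 + \<xi> e * t) * (poly q t)\<^sup>2" for t
      by (simp add: algebra_simps)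
    show "e \<in> {1..n}" using e n by auto
    show "[:1, \<xi> e:] * q\<^sup>2 \<noteq> 0" using q by (simp del: mult_pCons_left)
    show "0 \<le> poly ([:1, \<xi> e:] * q\<^sup>2) t" if "t \<in> {-1..1}" for t
      unfolding poly_e using e1 that by (intro mult_nonneg_nonneg) auto
    show "0 \<le> poly ([:1, \<xi> e:] * q\<^sup>2) (\<xi> e)"
      unfolding poly_e using e1 by (intro mult_nonneg_nonneg) auto
    show "poly ([:1, \<xi> e:] * q\<^sup>2) (\<xi> a) = 0" if a: "a \<in> {1..n} - {e}" for a
    proof (cases "a = 1 \<or> a = n")
      case True
      then have "\<xi> e * \<xi> a = -1" using a e first last by auto
      then show ?thesis unfolding poly_e by simp
    next
      case False
      then show ?thesis unfolding poly_e using interior[of a] a by simp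
    qed
  qed
  note 1 = endpoint[of 1, unfolded first] and 2 = endpoint[of n, unfolded last]
  have q_even: "(poly q (- t))\<^sup>2 = (poly q t)\<^sup>2" for t
    unfolding q_def by (rule poly_pderiv_legendre_minus_square)
  have "pcompose ([:1, -1:] * q\<^sup>2) [:0, -1:] = [:1, 1:] * q\<^sup>2"
  proof (rule poly_ext)
    fix t
    show "poly (pcompose ([:1, -1:] * q\<^sup>2) [:0, -1:]) t = poly ([:1, 1:] * q\<^sup>2) t"
      using q_even[of t] by (simp add: poly_pcompose del: mult_pCons_left)
  qed
  then have "w 1 * poly ([:1, -1:] * q\<^sup>2) (-1) = w n * poly ([:1, 1:] * q\<^sup>2) 1"
    using mean_value_reflect[of "[:1, -1:] * q\<^sup>2"] 1 2 by simp
  then show "w n = w 1"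
    using q_even[of 1] q_ends by simp
  fix b assume b: "b \<in> {1..n}"
  show "0 < w b"
  proof (cases "b = 1 \<or> b = n")
    case False
    let ?l = "node_poly \<xi> ({1..n} - {1, n, b})"
    have l: "poly ?l (\<xi> c) = 0" if "c \<in> {1..n} - {1, n, b}" for c
      using that by (auto simp: poly_node_poly)
    show ?thesis
    proof (rule conjunct2[OF weight_pos[OF exact b, where p = "[:1, 0, -1:] * ?l\<^sup>2"]])
      have "card ({1..n} - {1, n, b}) = n - 3"
        using b n False by (simp add: card_Diff_subset)
      then have "degree ([:1, 0, -1:] * ?l\<^sup>2) \<le> 2 + 2 * (n - 3)"
        by (intro order.trans[OF degree_mult_le]) (simp add: degree_power_eq degree_node_poly)
      also have "\<dots> \<le> 2 * n - 3" using b n False by auto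
      finally show "degree ([:1, 0, -1:] * ?l\<^sup>2) \<le> 2 * n - 3" .
      have pos: "0 \<le> poly ([:1, 0, -1:] * ?l\<^sup>2) t" if "\<bar>t\<bar> \<le> 1" for t
      proof -
        have "0 \<le> 1 - t\<^sup>2" using that by (simp add: abs_square_le_1)
        then have "0 \<le> (1 - t\<^sup>2) * (poly ?l t)\<^sup>2" by simp
        also have "\<dots> = poly ([:1, 0, -1:] * ?l\<^sup>2) t" by (simp add: power2_eq_square algebra_simps)
        finally show ?thesis .
      qed
      show "0 \<le> poly ([:1, 0, -1:] * ?l\<^sup>2) t" if "t \<in> {-1..1}" for t
        using that by (intro pos) auto
      show "0 \<le> poly ([:1, 0, -1:] * ?l\<^sup>2) (\<xi> b)" by (rule pos[OF node[OF b]])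
      show "[:1, 0, -1:] * ?l\<^sup>2 \<noteq> 0" by (simp del: mult_pCons_left)
      show "poly ([:1, 0, -1:] * ?l\<^sup>2) (\<xi> c) = 0" if "c \<in> {1..n} - {b}" for c
        using l[of c] that first last by (cases "c = 1 \<or> c = n") auto
    qed
  qed (use 1 2 in auto)
qed

section \<open>Cell averages as sums over quadrature nodes\<close>

lemma cell_quadrature_power:
  assumes exact: "exact_to_degree n \<xi> w d" and a: "a \<le> d" and z: "z (i - 1) < z i"
  shows "((\<lambda>t. t ^ a) has_integral
     (z i - z (i - 1)) * (\<Sum>b=1..n. w b * cell_node z \<xi> i b ^ a)) {z (i - 1)..z i}"
proof -
  define h where "h = (z i - z (i - 1)) / 2"
  define q where "q = [:(z (i - 1) + z i) / 2, h:]"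
  have h: "h > 0" using z by (simp add: h_def)
  have q: "poly q 1 = z i" "poly q (-1) = z (i - 1)" by (simp_all add: q_def h_def field_simps)
  have node: "poly q (\<xi> b) = cell_node z \<xi> i b" for b
    by (simp add: q_def h_def cell_node_def)
  have "degree (q ^ a) \<le> d"
    using a degree_power_le[of q a] order.trans by (fastforce simp: q_def split: if_splits)
  then have "(\<Sum>b=1..n. w b * cell_node z \<xi> i b ^ a) = mean_value (q ^ a)"
    using exact_to_degreeD[OF exact] by (simp add: node)
  \<comment> \<open>writing the integrand as a derivative reduces both integrals to end point values\<close>
  also have "q ^ a = pderiv (smult (1 / (h * real (Suc a))) (q ^ Suc a))"
    using h unfolding pderiv_smult pderiv_power_Suc
    by (simp add: q_def pderiv_pCons del: of_nat_Suc)
  also have "mean_value \<dots> = (z i ^ Suc a - z (i - 1) ^ Suc a) / (2 * h * real (Suc a))"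
    unfolding mean_value_pderiv poly_smult poly_power q
    by (simp add: diff_divide_distrib mult_ac del: of_nat_Suc power_Suc)
  finally have mean: "(\<Sum>b=1..n. w b * cell_node z \<xi> i b ^ a)
      = (z i ^ Suc a - z (i - 1) ^ Suc a) / (2 * h * real (Suc a))" .
  have "z i - z (i - 1) = 2 * h" by (simp add: h_def)
  then have eq: "(z i - z (i - 1)) * (\<Sum>b=1..n. w b * cell_node z \<xi> i b ^ a)
      = z i ^ Suc a / real (Suc a) - z (i - 1) ^ Suc a / real (Suc a)"
    using h unfolding mean by (simp add: diff_divide_distrib right_diff_distrib del: of_nat_Suc power_Suc)
  have "((\<lambda>t. t ^ Suc a / real (Suc a)) has_real_derivative t ^ a) (at t within X)" for t X
    by (rule derivative_eq_intros refl | simp del: of_nat_Suc)+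
  then show ?thesis unfolding eq using z
    by (intro fundamental_theorem_of_calculus)
       (auto simp: has_real_derivative_iff_has_vector_derivative[symmetric])
qed

lemma sum_Sigma_swap:
  "(\<Sum>a\<in>A. \<Sum>b\<in>B a. \<Sum>p\<in>P. f a b p) = (\<Sum>p\<in>P. \<Sum>a\<in>A. \<Sum>b\<in>B a. f a b p)"
proof -
  have "(\<Sum>a\<in>A. \<Sum>b\<in>B a. \<Sum>p\<in>P. f a b p) = (\<Sum>a\<in>A. \<Sum>p\<in>P. \<Sum>b\<in>B a. f a b p)"
    by (intro sum.cong refl sum.swap)
  also have "\<dots> = (\<Sum>p\<in>P. \<Sum>a\<in>A. \<Sum>b\<in>B a. f a b p)" by (rule sum.swap)
  finally show ?thesis .
qed

lemma cell_average_quadrature: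
  fixes U :: "int \<Rightarrow> int \<Rightarrow> real \<Rightarrow> real \<Rightarrow> 'a :: euclidean_space"
  assumes poly: "poly2_le K (U i j)"
    and x: "exact_to_degree n \<xi> w K" and y: "exact_to_degree m \<eta> v K"
    and xe: "xe (i - 1) < xe i" and ye: "ye (j - 1) < ye j"
  shows "cell_average xe ye U i j =
    (\<Sum>a=1..n. \<Sum>b=1..m. (w a * v b) *\<^sub>R U i j (cell_node xe \<xi> i a) (cell_node ye \<eta> j b))"
proof -
  obtain c where "\<forall>x y. U i j x y = (\<Sum>a\<le>K. \<Sum>b\<le>K - a. (x ^ a * y ^ b) *\<^sub>R c a b)"
    using poly unfolding poly2_le_def by (elim exE)
  note c = this[rule_format]
  define dx dy where "dx = xe i - xe (i - 1)" and "dy = ye j - ye (j - 1)"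
  define X where "X a = (\<Sum>\<alpha>=1..n. w \<alpha> * cell_node xe \<xi> i \<alpha> ^ a)" for a
  define Y where "Y b = (\<Sum>\<beta>=1..m. v \<beta> * cell_node ye \<eta> j \<beta> ^ b)" for b
  have X: "((\<lambda>t. t ^ a) has_integral dx * X a) {xe (i - 1)..xe i}" if "a \<le> K" for a
    unfolding dx_def X_def by (rule cell_quadrature_power[where z = xe, OF x that xe])
  have Y: "((\<lambda>t. t ^ b) has_integral dy * Y b) {ye (j - 1)..ye j}" if "b \<le> K" for b
    unfolding dy_def Y_def by (rule cell_quadrature_power[where z = ye, OF y that ye])
  have inner: "integral {ye (j - 1)..ye j} (\<lambda>y. U i j x y)
      = (\<Sum>a\<le>K. \<Sum>b\<le>K - a. (x ^ a * (dy * Y b)) *\<^sub>R c a b)" for x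
    unfolding c by (intro integral_unique has_integral_sum has_integral_scaleR_left
        has_integral_mult_right Y) auto
  have "continuous_on A (\<lambda>(x, y). U i j x y)" for A
    unfolding c case_prod_unfold by (intro continuous_intros)
  moreover have box: "{xe (i - 1)<..<xe i} \<times> {ye (j - 1)<..<ye j} = box (xe (i - 1), ye (j - 1)) (xe i, ye j)"
    by (auto simp: mem_box Basis_prod_def)
  ultimately have "integral ({xe (i - 1)<..<xe i} \<times> {ye (j - 1)<..<ye j}) (\<lambda>(x, y). U i j x y)
      = integral {xe (i - 1)..xe i} (\<lambda>x. integral {ye (j - 1)..ye j} (\<lambda>y. U i j x y))"
    using integral_open_interval[of "(xe (i - 1), ye (j - 1))" "(xe i, ye j)" "\<lambda>(x, y). U i j x y"]
      integral_prod_continuous[of "xe (i - 1)" "ye (j - 1)" "xe i" "ye j" "\<lambda>(x, y). U i j x y"]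
    by (simp add: box)
  also have "\<dots> = (\<Sum>a\<le>K. \<Sum>b\<le>K - a. ((dx * X a) * (dy * Y b)) *\<^sub>R c a b)"
    unfolding inner by (intro integral_unique has_integral_sum has_integral_scaleR_left
        has_integral_mult_left X) auto
  also have "\<dots> = (dx * dy) *\<^sub>R (\<Sum>a\<le>K. \<Sum>b\<le>K - a. (X a * Y b) *\<^sub>R c a b)"
    by (simp add: scaleR_sum_right mult_ac)
  finally have "cell_average xe ye U i j = (\<Sum>a\<le>K. \<Sum>b\<le>K - a. (X a * Y b) *\<^sub>R c a b)"
    using xe ye by (simp add: cell_average_def dx_def dy_def)
  also have "\<dots> = (\<Sum>a\<le>K. \<Sum>b\<le>K - a. \<Sum>\<alpha>=1..n. \<Sum>\<beta>=1..m.
     (w \<alpha> * v \<beta>) *\<^sub>R ((cell_node xe \<xi> i \<alpha> ^ a * cell_node ye \<eta> j \<beta> ^ b) *\<^sub>R c a b))"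
    unfolding X_def Y_def sum_product scaleR_sum_left by (simp add: mult_ac)
  also have "\<dots> = (\<Sum>\<alpha>=1..n. \<Sum>\<beta>=1..m. \<Sum>a\<le>K. \<Sum>b\<le>K - a.
     (w \<alpha> * v \<beta>) *\<^sub>R ((cell_node xe \<xi> i \<alpha> ^ a * cell_node ye \<eta> j \<beta> ^ b) *\<^sub>R c a b))"
    by (rule trans[OF sum_Sigma_swap sum.cong[OF refl sum_Sigma_swap]])
  also have "\<dots> = (\<Sum>\<alpha>=1..n. \<Sum>\<beta>=1..m.
     (w \<alpha> * v \<beta>) *\<^sub>R U i j (cell_node xe \<xi> i \<alpha>) (cell_node ye \<eta> j \<beta>))"
    by (simp add: c scaleR_sum_right)
  finally show ?thesis .
qed

section \<open>Positivity of the scheme\<close>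

text \<open>One cell in one direction: \<open>V\<close> lists the values at the Lobatto nodes, \<open>Up\<close> and \<open>Um\<close> are
the traces from the two neighbours, and \<open>q\<close>, \<open>r\<close>, \<open>s\<close> stand for \<open>p_mag u C\<close>, \<open>u\<^sub>k p_mag u C\<close>, \<open>u
\<bullet> C\<close>. The end point weights leave at least \<open>\<mu>\<close> times the end point values; together with the
fluxes these add up to \<open>\<mu> / 2\<close> times four expressions of the splitting inequality, up to the
jumps of the normal magnetic field, which are collected in the last summand because only the two
directions together balance them.\<close>

lemma one_dimensional_positivity:
  fixes \<phi> :: "state \<Rightarrow> real" and L :: nat
  assumes lin: "linear \<phi>"
    and split: "\<And>V \<sigma>. V \<in> admissible \<Gamma> \<Longrightarrow> \<sigma> \<in> {1, -1} \<Longrightarrow>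
       0 < \<phi> V + q + \<sigma> * (\<phi> (flux \<Gamma> k V) + (r - magnetic V $ k * s))"
    and L: "2 \<le> L" and w: "\<And>a. a \<in> {1..L} \<Longrightarrow> 0 < w a" and wL: "w L = w 1" and sum: "(\<Sum>a=1..L. w a) = 1"
    and lam: "0 < \<mu>" "\<mu> \<le> w 1"
    and V: "\<And>a. a \<in> {1..L} \<Longrightarrow> V a \<in> admissible \<Gamma>"
    and Up: "Up \<in> admissible \<Gamma>" and Um: "Um \<in> admissible \<Gamma>"
  shows "0 < (\<Sum>a=1..L. w a * \<phi> (V a)) + q
    - \<mu> * (\<phi> (numerical_flux \<Gamma> k (V L) Up) - \<phi> (numerical_flux \<Gamma> k Um (V 1)))
    + \<mu> * s / 2 * (magnetic (V L) $ k + magnetic Up $ k - magnetic Um $ k - magnetic (V 1) $ k)"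
proof -
  define A where "A V = \<phi> V + q" for V
  define S where "S \<sigma> V = \<phi> V + q + \<sigma> * (\<phi> (flux \<Gamma> k V) + (r - magnetic V $ k * s))" for \<sigma> V
  have A: "0 < A V" if "V \<in> admissible \<Gamma>" for V
    using split[OF that, of 1] split[OF that, of "-1"] by (simp add: A_def)
  have ends: "V 1 \<in> admissible \<Gamma>" "V L \<in> admissible \<Gamma>" using V L by auto
  have "\<mu> * A (V 1) + \<mu> * A (V L) \<le> w 1 * A (V 1) + w L * A (V L)"
    using A[OF ends(1)] A[OF ends(2)] lam wL by (intro add_mono mult_right_mono) auto
  also have "\<dots> = (\<Sum>a\<in>{1, L}. w a * A (V a))" using L by simp
  also have "\<dots> \<le> (\<Sum>a=1..L. w a * A (V a))"
    using L by (intro sum_mono2) (auto intro!: less_imp_le[OF mult_pos_pos] w A V)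
  also have "\<dots> = (\<Sum>a=1..L. w a * \<phi> (V a)) + q"
    using sum by (simp add: A_def distrib_left sum.distrib flip: sum_distrib_right)
  finally have nodes: "\<mu> * A (V 1) + \<mu> * A (V L) \<le> (\<Sum>a=1..L. w a * \<phi> (V a)) + q" .
  have "0 < S (-1) Up + S 1 Um + S (-1) (V L) + S 1 (V 1)"
    unfolding S_def by (intro add_pos_pos split Up Um ends) auto
  then have "0 < \<mu> / 2 * (S (-1) Up + S 1 Um + S (-1) (V L) + S 1 (V 1))"
    using lam by simp
  also have "\<dots> = \<mu> * A (V 1) + \<mu> * A (V L)
    - \<mu> * (\<phi> (numerical_flux \<Gamma> k (V L) Up) - \<phi> (numerical_flux \<Gamma> k Um (V 1)))
    + \<mu> * s / 2 * (magnetic (V L) $ k + magnetic Up $ k - magnetic Um $ k - magnetic (V 1) $ k)"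
    unfolding numerical_flux_def linear_scale[OF lin] linear_diff[OF lin] linear_add[OF lin]
      A_def S_def real_scaleR_def by (simp add: field_simps)
  finally show ?thesis using nodes by linarith
qed

theorem theorem3p5:
  fixes \<Gamma> dx dy dt :: real
    and K Q L :: nat
    and xe ye :: "int \<Rightarrow> real"
    and \<xi> \<omega> \<xi>' \<omega>' :: "nat \<Rightarrow> real"
    and U :: "int \<Rightarrow> int \<Rightarrow> real \<Rightarrow> real \<Rightarrow> state"
    and Uxm Uxp Uym Uyp :: "int \<Rightarrow> int \<Rightarrow> nat \<Rightarrow> state"
    and Unew :: "int \<Rightarrow> int \<Rightarrow> state"
  assumes Gamma: "1 < \<Gamma>" "\<Gamma> \<le> 2"
    and steps: "0 < dx" "0 < dy"
    and mesh_x: "\<And>i. xe i - xe (i - 1) = dx"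
    and mesh_y: "\<And>j. ye j - ye (j - 1) = dy"
    and K: "1 \<le> K"
    and Q: "real Q \<ge> (real K + 1) / 2"
    and L: "real L \<ge> (real K + 3) / 2"
    and gauss: "gauss_legendre_rule Q \<xi> \<omega>"
    and lobatto: "gauss_lobatto_rule L \<xi>' \<omega>'"
    and poly: "\<And>i j. poly2_le K (U i j)"
    \<comment> \<open>traces at the edges $(i+1/2, \beta)$ of cell $(i,j)$ and $(\beta, j+1/2)$ of cell $(i,j)$\<close>
    and Uxm: "\<And>i j b. Uxm i j b = U i j (xe i) (cell_node ye \<xi> j b)"
    and Uxp: "\<And>i j b. Uxp i j b = U (i + 1) j (xe i) (cell_node ye \<xi> j b)"
    and Uym: "\<And>i j b. Uym i j b = U i j (cell_node xe \<xi> i b) (ye j)"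
    and Uyp: "\<And>i j b. Uyp i j b = U i (j + 1) (cell_node xe \<xi> i b) (ye j)"
    and scheme: "\<And>i j. Unew i j = cell_average xe ye U i j
      - (dt / dx) *\<^sub>R (\<Sum>b=1..Q. \<omega> b *\<^sub>R
          (numerical_flux \<Gamma> 1 (Uxm i j b) (Uxp i j b)
            - numerical_flux \<Gamma> 1 (Uxm (i - 1) j b) (Uxp (i - 1) j b)))
      - (dt / dy) *\<^sub>R (\<Sum>b=1..Q. \<omega> b *\<^sub>R
          (numerical_flux \<Gamma> 2 (Uym i j b) (Uyp i j b)
            - numerical_flux \<Gamma> 2 (Uym i (j - 1) b) (Uyp i (j - 1) b)))"
    and div_free_in: "\<And>i j.
      (1 / dx) * (\<Sum>b=1..Q. \<omega> b * (magnetic (Uxm i j b) $ 1 - magnetic (Uxp (i - 1) j b) $ 1))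
      + (1 / dy) * (\<Sum>b=1..Q. \<omega> b * (magnetic (Uym i j b) $ 2 - magnetic (Uyp i (j - 1) b) $ 2)) = 0"
    and div_free_out: "\<And>i j.
      (1 / dx) * (\<Sum>b=1..Q. \<omega> b * (magnetic (Uxp i j b) $ 1 - magnetic (Uxm (i - 1) j b) $ 1))
      + (1 / dy) * (\<Sum>b=1..Q. \<omega> b * (magnetic (Uyp i j b) $ 2 - magnetic (Uym i (j - 1) b) $ 2)) = 0"
    and admissible_x: "\<And>i j a b. a \<in> {1..L} \<Longrightarrow> b \<in> {1..Q} \<Longrightarrow>
      U i j (cell_node xe \<xi>' i a) (cell_node ye \<xi> j b) \<in> admissible \<Gamma>"
    and admissible_y: "\<And>i j a b. a \<in> {1..L} \<Longrightarrow> b \<in> {1..Q} \<Longrightarrow>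
      U i j (cell_node xe \<xi> i b) (cell_node ye \<xi>' j a) \<in> admissible \<Gamma>"
    and CFL: "0 < dt / dx + dt / dy" "dt / dx + dt / dy \<le> \<omega>' 1"
  shows "\<forall>i j. Unew i j \<in> admissible \<Gamma>"
proof (intro allI)
  fix i j
  have "real (K + 1) \<le> real (2 * Q)" "real (K + 3) \<le> real (2 * L)" using Q L by simp_all
  then have "K + 1 \<le> 2 * Q" "K + 3 \<le> 2 * L" unfolding of_nat_le_iff .
  then have Q1: "1 \<le> Q" and QK: "K \<le> 2 * Q - 1" and L2: "2 \<le> L" and LK: "K \<le> 2 * L - 3"
    using K by auto
  note G = gauss_legendre[OF gauss Q1] and GL = gauss_lobatto[OF lobatto L2]
  have G_exact: "exact_to_degree Q \<xi> \<omega> K" and GL_exact: "exact_to_degree L \<xi>' \<omega>' K"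
    using exact_to_degree_mono[OF G(1) QK] exact_to_degree_mono[OF GL(1) LK] by auto
  have sum_w: "(\<Sum>b=1..Q. \<omega> b) = 1" "(\<Sum>b=1..L. \<omega>' b) = 1"
    using exact_to_degreeD[OF G_exact, of 1] exact_to_degreeD[OF GL_exact, of 1] by simp_all
  have ends: "cell_node z \<xi>' k 1 = z (k - 1)" "cell_node z \<xi>' k L = z k" for z k
    unfolding cell_node_def GL by (simp_all add: field_simps)
  have "xe (i - 1) < xe i" "ye (j - 1) < ye j" using mesh_x[of i] mesh_y[of j] steps by linarith+
  note average = cell_average_quadrature[OF poly _ _ this]
  define \<mu>x \<mu>y where "\<mu>x = dt / dx" and "\<mu>y = dt / dy"
  define \<mu> where "\<mu> = \<mu>x + \<mu>y"
  have "0 < dt * (1 / dx + 1 / dy)" using CFL(1) by (simp add: algebra_simps)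
  moreover have "0 < 1 / dx + 1 / dy" using steps by (simp add: add_pos_pos)
  ultimately have "0 < dt" using zero_less_mult_pos2 by blast
  then have \<mu>_pos: "0 < \<mu>x" "0 < \<mu>y" using steps by (simp_all add: \<mu>x_def \<mu>y_def)
  then have \<mu>: "0 < \<mu>" "\<mu> \<le> \<omega>' 1" using CFL by (simp_all add: \<mu>_def \<mu>x_def \<mu>y_def)
  \<comment> \<open>stated for a general functional, as it is needed for the density as well\<close>
  have positive: "0 < \<phi> (Unew i j) + q"
    if lin: "linear \<phi>"
      and split: "\<And>k V \<sigma>. V \<in> admissible \<Gamma> \<Longrightarrow> \<sigma> \<in> {1, -1} \<Longrightarrow>
         0 < \<phi> V + q + \<sigma> * (\<phi> (flux \<Gamma> k V) + (r k - magnetic V $ k * s))"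
    for \<phi> :: "state \<Rightarrow> real" and q s and r :: "3 \<Rightarrow> real"
  proof -
    define Fx where "Fx b = \<phi> (numerical_flux \<Gamma> 1 (Uxm i j b) (Uxp i j b))
      - \<phi> (numerical_flux \<Gamma> 1 (Uxm (i - 1) j b) (Uxp (i - 1) j b))" for b
    define Fy where "Fy b = \<phi> (numerical_flux \<Gamma> 2 (Uym i j b) (Uyp i j b))
      - \<phi> (numerical_flux \<Gamma> 2 (Uym i (j - 1) b) (Uyp i (j - 1) b))" for b
    define Bx where "Bx b = magnetic (Uxm i j b) $ 1 + magnetic (Uxp i j b) $ 1
      - magnetic (Uxm (i - 1) j b) $ 1 - magnetic (Uxp (i - 1) j b) $ 1" for b
    define By where "By b = magnetic (Uym i j b) $ 2 + magnetic (Uyp i j b) $ 2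
      - magnetic (Uym i (j - 1) b) $ 2 - magnetic (Uyp i (j - 1) b) $ 2" for b
    define Px where "Px b = (\<Sum>a=1..L. \<omega>' a * \<phi> (U i j (cell_node xe \<xi>' i a) (cell_node ye \<xi> j b)))" for b
    define Py where "Py b = (\<Sum>a=1..L. \<omega>' a * \<phi> (U i j (cell_node xe \<xi> i b) (cell_node ye \<xi>' j a)))" for b
    have x: "0 < Px b + q - \<mu> * Fx b + \<mu> * s / 2 * Bx b" if b: "b \<in> {1..Q}" for b
    proof -
      have "Uxp i j b \<in> admissible \<Gamma>" "Uxm (i - 1) j b \<in> admissible \<Gamma>"
        using admissible_x[of 1 b "i + 1" j] admissible_x[of L b "i - 1" j] b L2
        unfolding ends Uxp Uxm by auto
      note adm = this admissible_x[OF _ b]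
      define V where "V a = U i j (cell_node xe \<xi>' i a) (cell_node ye \<xi> j b)" for a
      have V: "Uxm i j b = V L" "Uxp (i - 1) j b = V 1" by (simp_all only: Uxm Uxp V_def ends) simp
      show ?thesis unfolding Px_def Fx_def Bx_def V V_def[symmetric]
        by (rule one_dimensional_positivity[OF lin _ L2 _ GL(5) sum_w(2) \<mu>])
           (unfold V_def, (rule split GL(2) adm | assumption)+)
    qed
    have y: "0 < Py b + q - \<mu> * Fy b + \<mu> * s / 2 * By b" if b: "b \<in> {1..Q}" for b
    proof -
      have "Uyp i j b \<in> admissible \<Gamma>" "Uym i (j - 1) b \<in> admissible \<Gamma>"
        using admissible_y[of 1 b i "j + 1"] admissible_y[of L b i "j - 1"] b L2
        unfolding ends Uyp Uym by auto
      note adm = this admissible_y[OF _ b]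
      define V where "V a = U i j (cell_node xe \<xi> i b) (cell_node ye \<xi>' j a)" for a
      have V: "Uym i j b = V L" "Uyp i (j - 1) b = V 1" by (simp_all only: Uym Uyp V_def ends) simp
      show ?thesis unfolding Py_def Fy_def By_def V V_def[symmetric]
        by (rule one_dimensional_positivity[OF lin _ L2 _ GL(5) sum_w(2) \<mu>])
           (unfold V_def, (rule split GL(2) adm | assumption)+)
    qed
    \<comment> \<open>the same cell average, computed with Lobatto nodes in the first or in the second direction\<close>
    have avg_x: "\<phi> (cell_average xe ye U i j) = (\<Sum>b=1..Q. \<omega> b * Px b)"
      unfolding average[OF GL_exact G_exact] Px_def linear_sum[OF lin] linear_scale[OF lin] o_def
      by (subst sum.swap) (simp add: sum_distrib_left mult_ac)
    have avg_y: "\<phi> (cell_average xe ye U i j) = (\<Sum>b=1..Q. \<omega> b * Py b)"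
      unfolding average[OF G_exact GL_exact] Py_def linear_sum[OF lin] linear_scale[OF lin] o_def
      by (simp add: sum_distrib_left mult_ac)
    have combine: "(\<Sum>b=1..Q. \<omega> b * (P b + q - \<mu> * F b + \<mu> * s / 2 * B b))
      = (\<Sum>b=1..Q. \<omega> b * P b) + q - \<mu> * (\<Sum>b=1..Q. \<omega> b * F b)
        + \<mu> * s / 2 * (\<Sum>b=1..Q. \<omega> b * B b)" for P F B :: "nat \<Rightarrow> real"
    proof -
      have "(\<Sum>b=1..Q. \<omega> b * (P b + q - \<mu> * F b + \<mu> * s / 2 * B b))
        = (\<Sum>b=1..Q. \<omega> b * P b + \<omega> b * q - \<mu> * (\<omega> b * F b) + \<mu> * s / 2 * (\<omega> b * B b))"
        by (intro sum.cong) (simp_all add: algebra_simps)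
      also have "\<dots> = (\<Sum>b=1..Q. \<omega> b * P b) + (\<Sum>b=1..Q. \<omega> b) * q - \<mu> * (\<Sum>b=1..Q. \<omega> b * F b)
        + \<mu> * s / 2 * (\<Sum>b=1..Q. \<omega> b * B b)"
        by (simp only: sum.distrib sum_subtractf sum_distrib_left sum_distrib_right)
      finally show ?thesis unfolding sum_w by simp
    qed
    have div: "\<mu>x * (\<Sum>b=1..Q. \<omega> b * Bx b) + \<mu>y * (\<Sum>b=1..Q. \<omega> b * By b) = 0"
    proof -
      have "\<mu>x * (\<Sum>b=1..Q. \<omega> b * Bx b) + \<mu>y * (\<Sum>b=1..Q. \<omega> b * By b) = dt *
        (((1 / dx) * (\<Sum>b=1..Q. \<omega> b * (magnetic (Uxm i j b) $ 1 - magnetic (Uxp (i - 1) j b) $ 1))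
      + (1 / dy) * (\<Sum>b=1..Q. \<omega> b * (magnetic (Uym i j b) $ 2 - magnetic (Uyp i (j - 1) b) $ 2)))
      + ((1 / dx) * (\<Sum>b=1..Q. \<omega> b * (magnetic (Uxp i j b) $ 1 - magnetic (Uxm (i - 1) j b) $ 1))
      + (1 / dy) * (\<Sum>b=1..Q. \<omega> b * (magnetic (Uyp i j b) $ 2 - magnetic (Uym i (j - 1) b) $ 2))))"
        unfolding \<mu>x_def \<mu>y_def Bx_def By_def
        by (simp add: algebra_simps sum.distrib sum_subtractf)
      then show ?thesis unfolding div_free_in div_free_out by simp
    qed
    have new: "\<phi> (Unew i j) = \<phi> (cell_average xe ye U i j)
        - \<mu>x * (\<Sum>b=1..Q. \<omega> b * Fx b) - \<mu>y * (\<Sum>b=1..Q. \<omega> b * Fy b)"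
      unfolding scheme linear_diff[OF lin] linear_scale[OF lin] linear_sum[OF lin] o_def
      by (simp add: \<mu>x_def \<mu>y_def Fx_def Fy_def)
    have sum_pos: "0 < (\<Sum>b=1..Q. \<omega> b * f b)" if "\<And>b. b \<in> {1..Q} \<Longrightarrow> 0 < f b" for f :: "nat \<Rightarrow> real"
      using Q1 by (intro sum_pos) (auto intro!: mult_pos_pos that G(2))
    define A where "A = \<phi> (cell_average xe ye U i j)"
    define SFx SFy SBx SBy where "SFx = (\<Sum>b=1..Q. \<omega> b * Fx b)" and "SFy = (\<Sum>b=1..Q. \<omega> b * Fy b)"
      and "SBx = (\<Sum>b=1..Q. \<omega> b * Bx b)" and "SBy = (\<Sum>b=1..Q. \<omega> b * By b)"
    have "0 < (\<Sum>b=1..Q. \<omega> b * (Px b + q - \<mu> * Fx b + \<mu> * s / 2 * Bx b))"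
      "0 < (\<Sum>b=1..Q. \<omega> b * (Py b + q - \<mu> * Fy b + \<mu> * s / 2 * By b))"
      by (rule sum_pos[of "\<lambda>b. Px b + q - \<mu> * Fx b + \<mu> * s / 2 * Bx b", OF x], assumption)
        (rule sum_pos[of "\<lambda>b. Py b + q - \<mu> * Fy b + \<mu> * s / 2 * By b", OF y], assumption)
    then have "0 < A + q - \<mu> * SFx + \<mu> * s / 2 * SBx" "0 < A + q - \<mu> * SFy + \<mu> * s / 2 * SBy"
      unfolding combine avg_x[symmetric] avg_y[symmetric] A_def SFx_def SFy_def SBx_def SBy_def .
    \<comment> \<open>with the weights \<open>\<mu>x\<close> and \<open>\<mu>y\<close> the jumps of the magnetic field add up to the discrete divergences\<close>
    then have "0 < \<mu>x * (A + q - \<mu> * SFx + \<mu> * s / 2 * SBx) + \<mu>y * (A + q - \<mu> * SFy + \<mu> * s / 2 * SBy)"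
      using \<mu>_pos by (metis add_pos_pos mult_pos_pos)
    also have "\<dots> = (\<mu>x + \<mu>y) * (A + q) - \<mu> * (\<mu>x * SFx + \<mu>y * SFy) + \<mu> * s / 2 * (\<mu>x * SBx + \<mu>y * SBy)"
      by (simp add: algebra_simps)
    also have "\<dots> = \<mu> * (\<phi> (Unew i j) + q)"
      unfolding new div[folded SBx_def SBy_def] SFx_def[symmetric] SFy_def[symmetric] A_def[symmetric]
        \<mu>_def[symmetric] by (simp add: algebra_simps)
    finally show ?thesis using \<mu>(1) by (simp add: zero_less_mult_iff)
  qed
  obtain D m B E where new: "Unew i j = (D, m, B, E)" by (cases "Unew i j")
  show "Unew i j \<in> admissible \<Gamma>"
    unfolding new
  proof (rule admissibleI[OF Gamma])
    have "0 < fst (Unew i j) + 0"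
      by (rule positive[where r = "\<lambda>_. 0" and s = 0])
         (auto intro: density_splitting bounded_linear.linear[OF bounded_linear_fst] simp: linear_fst)
    then show "0 < D" by (simp add: new)
  next
    fix u C :: "real^3" assume u: "norm u < 1"
    have "0 < Unew i j \<bullet> lorentz_normal u C + p_mag u C"
    proof (rule positive[where r = "\<lambda>k. u $ k * p_mag u C" and s = "u \<bullet> C"])
      show "linear (\<lambda>V. V \<bullet> lorentz_normal u C)"
        by (rule bounded_linear.linear[OF bounded_linear_inner_left])
    qed (rule flux_splitting[OF Gamma _ _ u])
    then show "0 < (D, m, B, E) \<bullet> lorentz_normal u C + p_mag u C" by (simp add: new)
  qed
qed

end
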